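(* Let $X$ be a metric space with Borel $\sigma$-algebra $\mathcal{A}$, and let $(X,\mathcal{A},\mu,T)$ be a measure preserving system with a super-polynomial decay of correlations. Let $f:X\to\mathbb{R}^N$ be a Lipschitz function. Then \[\underline{R}^f(x)=\underline{d}^f_\mu(x)\qquad\text{and}\qquad\overline{R}^f(x)=\overline{d}^f_\mu(x)\] for $\mu$-almost every $x$ such that $\underline{d}^f_\mu(x)>0$.
   Context: A measure preserving system $(X,\mathcal{A},\mu,T)$ consists of a set $X$ with a $\sigma$-algebra $\mathcal{A}$, a measure $\mu$ on $(X,\mathcal{A})$ with $\mu(X)=1$, and a measurable map $T:X\to X$ such that $\mu(T^{-1}A)=\mu(A)$ for all $A\in\mathcal{A}$. Super-polynomial decay of correlations: there is a sequence $(\theta_n)_{n\ge1}$ with $\lim_{n\to\infty}\theta_n n^p=0$ for all $p>0$ such that, for all bounded Lipschitz functions $\phi,\psi:X\to\mathbb{R}$ and all integers $n\ge1$, \[\left|\int_X\phi\circ T^n\,\psi\,d\mu-\int_X\phi\,d\mu\int_X\psi\,d\mu\right|\leq\|\phi\|\,\|\psi\|\,\theta_n,\] where $\|\phi\|=\sup|\phi|+\mathrm{Lip}(\phi)$ is the Lipschitz norm. $B(y,r)$ is the open ball with center $y$ and radius $r$ in $\mathbb{R}^N$, with respect to the Euclidean distance. For $x\in X$, $r>0$, $p\in\mathbb{N}$, the $p$-non-instantaneous return time for the observation is \[\tau^f_{r,p}(x):=\inf\{k>p : k\in\mathbb{N},\ f(T^kx)\in B(f(x),r)\}\] (with $\inf\emptyset=+\infty$,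 $\log(+\infty)=+\infty$), and \[\underline{R}^f(x):=\lim_{p\to\infty}\liminf_{r\to0}\frac{\log\tau^f_{r,p}(x)}{-\log r},\qquad \overline{R}^f(x):=\lim_{p\to\infty}\limsup_{r\to0}\frac{\log\tau^f_{r,p}(x)}{-\log r}.\] The lower and upper pointwise dimensions of a Borel probability measure $\nu$ on $\mathbb{R}^N$ at $y$ are \[\underline{d}_\nu(y)=\liminf_{r\to0}\frac{\log\nu(B(y,r))}{\log r},\qquad \overline{d}_\nu(y)=\limsup_{r\to0}\frac{\log\nu(B(y,r))}{\log r}.\] With the pushforward $f_*\mu(\cdot):=\mu(f^{-1}(\cdot))$, set $\underline{d}^f_\mu(x)=\underline{d}_{f_*\mu}(f(x))$ and $\overline{d}^f_\mu(x)=\overline{d}_{f_*\mu}(f(x))$. *)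

theory Defs
  imports "HOL-Probability.Probability"
begin

unbundle lipschitz_syntax

definition measure_preserving_system :: "'a measure \<Rightarrow> ('a \<Rightarrow> 'a) \<Rightarrow> bool" where
  "measure_preserving_system M T \<longleftrightarrow>
     prob_space M \<and> T \<in> measurable M M \<and>
     (\<forall>A\<in>sets M. emeasure M (T -` A \<inter> space M) = emeasure M A)"

definition Lipschitz :: "('a::metric_space \<Rightarrow> 'b::metric_space) \<Rightarrow> bool" where
  "Lipschitz f \<longleftrightarrow> (\<exists>C. C-lipschitz_on UNIV f)"

text \<open>The infimum below is the least Lipschitz constant. Both summands are meaningful
  only for bounded Lipschitz functions, the only ones to which the norm is applied.\<close>

definition lipschitz_norm :: "('a::metric_space \<Rightarrow> real) \<Rightarrow> real" where
  "lipschitz_norm \<phi> = (SUP x. \<bar>\<phi> x\<bar>) + Inf {C. C-lipschitz_on UNIV \<phi>}"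

definition superpolynomial_decay :: "'a::metric_space measure \<Rightarrow> ('a \<Rightarrow> 'a) \<Rightarrow> bool" where
  "superpolynomial_decay M T \<longleftrightarrow>
     (\<exists>\<theta> :: nat \<Rightarrow> real.
        (\<forall>p::real. p > 0 \<longrightarrow> (\<lambda>n. \<theta> n * real n powr p) \<longlonglongrightarrow> 0) \<and>
        (\<forall>\<phi> \<psi> :: 'a \<Rightarrow> real.
           bounded (range \<phi>) \<longrightarrow> Lipschitz \<phi> \<longrightarrow> bounded (range \<psi>) \<longrightarrow> Lipschitz \<psi> \<longrightarrow>
           (\<forall>n\<ge>1. \<bar>(\<integral>x. \<phi> ((T ^^ n) x) * \<psi> x \<partial>M) - (\<integral>x. \<phi> x \<partial>M) * (\<integral>x. \<psi> x \<partial>M)\<bar>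
                    \<le> lipschitz_norm \<phi> * lipschitz_norm \<psi> * \<theta> n)))"

text \<open>The library function \<open>ln\<close> has \<open>ln 0 = 0\<close>, whereas null balls and infinite return
  times require \<open>log 0 = -\<infinity>\<close> and \<open>log \<infinity> = \<infinity>\<close>.\<close>

definition elog :: "ennreal \<Rightarrow> ereal" where
  "elog x = (if x = 0 then -\<infinity> else if x = \<infinity> then \<infinity> else ereal (ln (enn2real x)))"

text \<open>The infimum of the empty set in \<^typ>\<open>enat\<close> is \<open>\<infinity>\<close>.\<close>

definition return_time ::
  "('a \<Rightarrow> 'a) \<Rightarrow> ('a \<Rightarrow> 'b::metric_space) \<Rightarrow> real \<Rightarrow> nat \<Rightarrow> 'a \<Rightarrow> enat" where
  "return_time T f r p x = Inf {enat k |k. k > p \<and> f ((T ^^ k) x) \<in> ball (f x) r}"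

text \<open>The outer limits exist because the return time is nondecreasing in \<open>p\<close>.\<close>

definition lower_recurrence_rate ::
  "('a \<Rightarrow> 'a) \<Rightarrow> ('a \<Rightarrow> 'b::metric_space) \<Rightarrow> 'a \<Rightarrow> ereal" where
  "lower_recurrence_rate T f x =
     lim (\<lambda>p. Liminf (at_right 0)
       (\<lambda>r. elog (ennreal_of_enat (return_time T f r p x)) / ereal (- ln r)))"

definition upper_recurrence_rate ::
  "('a \<Rightarrow> 'a) \<Rightarrow> ('a \<Rightarrow> 'b::metric_space) \<Rightarrow> 'a \<Rightarrow> ereal" where
  "upper_recurrence_rate T f x =
     lim (\<lambda>p. Limsup (at_right 0)
       (\<lambda>r. elog (ennreal_of_enat (return_time T f r p x)) / ereal (- ln r)))"

definition lower_dimension :: "'b::metric_space measure \<Rightarrow> 'b \<Rightarrow> ereal" where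
  "lower_dimension \<nu> y =
     Liminf (at_right 0) (\<lambda>r. elog (emeasure \<nu> (ball y r)) / ereal (ln r))"

definition upper_dimension :: "'b::metric_space measure \<Rightarrow> 'b \<Rightarrow> ereal" where
  "upper_dimension \<nu> y =
     Limsup (at_right 0) (\<lambda>r. elog (emeasure \<nu> (ball y r)) / ereal (ln r))"

definition lower_dimension_obs ::
  "'a measure \<Rightarrow> ('a \<Rightarrow> 'b::metric_space) \<Rightarrow> 'a \<Rightarrow> ereal" where
  "lower_dimension_obs M f x = lower_dimension (distr M borel f) (f x)"

definition upper_dimension_obs ::
  "'a measure \<Rightarrow> ('a \<Rightarrow> 'b::metric_space) \<Rightarrow> 'a \<Rightarrow> ereal" where
  "upper_dimension_obs M f x = upper_dimension (distr M borel f) (f x)"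

end

theory Submission
  imports Defs
begin

text \<open>
  Write \<open>\<nu>\<close> for the image of \<open>M\<close> under \<open>f\<close> and let \<open>r = 2\<^sup>-\<^sup>k\<close>. By a Kac type inequality a point of a set
  \<open>A\<close> rarely waits much longer than \<open>1/M(A)\<close> to return to \<open>A\<close>; applied to preimages of balls and combined
  with Borel-Cantelli this bounds the recurrence rates by the dimensions. Conversely, decay of
  correlations, applied to Lipschitz cutoffs of balls of radius \<open>r\<close>, shows that the pair
  \<open>(f x, f (T\<^sup>j x))\<close> hits such a ball with probability about \<open>\<nu>(B)\<^sup>2\<close>, up to an error \<open>\<theta>\<^sub>j / r\<^sup>2\<close> that is
  negligible once \<open>j\<close> exceeds a fixed negative power of \<open>r\<close>. So almost surely no return occurs
  between that time and \<open>r\<^sup>\<epsilon>/\<nu>(B(f x, 3r))\<close>. Earlier returns are excluded where the lower dimension is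
  positive: there, for a large fixed \<open>b\<close>, almost surely \<open>f (T\<^sup>j x)\<close> is at distance at least
  \<open>j\<^sup>-\<^sup>b\<close> from \<open>f x\<close> for all large \<open>j\<close>.
  Estimates local to a ball are globalised by integrating over its centre with respect to Lebesgue
  measure, which replaces covering arguments.
\<close>

section \<open>Decay sequences, Lipschitz cutoffs and elementary sums\<close>

lemma superpolynomial_bound:
  fixes \<theta> :: "nat \<Rightarrow> real"
  assumes "\<And>p. 0 < p \<Longrightarrow> (\<lambda>n. \<theta> n * real n powr p) \<longlonglongrightarrow> 0" and "0 < q"
  obtains C where "0 \<le> C" "\<And>n. 1 \<le> n \<Longrightarrow> \<bar>\<theta> n\<bar> \<le> C / real n ^ q"
proof -
  have "Bseq (\<lambda>n. \<theta> n * real n powr real q)"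
    using assms(1)[of "real q"] assms(2) by (intro convergent_imp_Bseq) (auto simp: convergent_def)
  then obtain C where C: "0 < C" "\<And>n. \<bar>\<theta> n * real n powr real q\<bar> \<le> C"
    by (auto elim: BseqE)
  have "\<bar>\<theta> n\<bar> \<le> C / real n ^ q" if "1 \<le> n" for n
    using C(2)[of n] that by (simp add: powr_realpow abs_mult pos_le_divide_eq)
  then show thesis using C by (intro that[of C]) auto
qed

lemma lipschitz_norm_bounds:
  assumes "C-lipschitz_on UNIV \<phi>" "\<And>x. \<bar>\<phi> x\<bar> \<le> B"
  shows "0 \<le> lipschitz_norm \<phi>" "lipschitz_norm \<phi> \<le> B + C"
proof -
  have "bdd_above (range (\<lambda>x. \<bar>\<phi> x\<bar>))" using assms(2) by (intro bdd_aboveI[of _ B]) auto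
  then have "0 \<le> (SUP x. \<bar>\<phi> x\<bar>)" by (intro cSUP_upper2[of _ _ undefined]) auto
  moreover have "(SUP x. \<bar>\<phi> x\<bar>) \<le> B" using assms(2) by (intro cSUP_least) auto
  moreover have "0 \<le> Inf {C. C-lipschitz_on UNIV \<phi>}"
    using assms(1) by (intro cInf_greatest) (auto dest: lipschitz_on_nonneg)
  moreover have "Inf {C. C-lipschitz_on UNIV \<phi>} \<le> C"
    using assms(1) by (intro cInf_lower bdd_belowI[of _ 0]) (auto dest: lipschitz_on_nonneg)
  ultimately show "0 \<le> lipschitz_norm \<phi>" "lipschitz_norm \<phi> \<le> B + C"
    by (auto simp: lipschitz_norm_def)
qed

text \<open>A piecewise linear cutoff, for \<open>r > 0\<close> with plateau radius
  \<open>3 * r / 2\<close> and support radius \<open>2 * r\<close>. The plateau is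
  \<open>r / 2 + r\<close>: if \<open>z\<close> is within \<open>r / 2\<close> of \<open>y\<close>,
  the value is 1 at every point within \<open>r\<close> of \<open>z\<close>.\<close>

definition cutoff :: "'b::metric_space \<Rightarrow> real \<Rightarrow> 'b \<Rightarrow> real" where
  "cutoff y r z = max 0 (min 1 (4 - 2 * dist y z / r))"

lemma cutoff_bounds: "0 \<le> cutoff y r z" "cutoff y r z \<le> 1"
  by (auto simp: cutoff_def)

lemma cutoff_eq_1: "0 < r \<Longrightarrow> dist y z \<le> 3 * r / 2 \<Longrightarrow> cutoff y r z = 1"
  by (simp add: cutoff_def field_simps)

lemma cutoff_eq_0: "0 < r \<Longrightarrow> 2 * r \<le> dist y z \<Longrightarrow> cutoff y r z = 0"
  by (simp add: cutoff_def field_simps)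

lemma lipschitz_cutoff:
  assumes "0 < r"
  shows "(2 / r)-lipschitz_on UNIV (cutoff y r)"
proof (rule lipschitz_onI)
  fix z w
  have "\<bar>cutoff y r z - cutoff y r w\<bar> \<le> \<bar>2 * dist y z / r - 2 * dist y w / r\<bar>"
  proof -
    have "\<bar>max 0 (min 1 (4 - a)) - max 0 (min 1 (4 - b))\<bar> \<le> \<bar>a - b\<bar>" for a b :: real by linarith
    then show ?thesis unfolding cutoff_def .
  qed
  also have "\<dots> = 2 / r * \<bar>dist y z - dist y w\<bar>"
  proof -
    have "2 * dist y z / r - 2 * dist y w / r = 2 / r * (dist y z - dist y w)"
      by (simp add: diff_divide_distrib right_diff_distrib)
    then show ?thesis using assms by (simp only: abs_mult) simp
  qed
  also have "\<dots> \<le> 2 / r * dist z w"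
    using assms abs_dist_diff_le[of z y w] by (intro mult_left_mono) (auto simp: dist_commute)
  finally show "dist (cutoff y r z) (cutoff y r w) \<le> 2 / r * dist z w" by (simp add: dist_real_def)
qed (use assms in simp)

text \<open>For \<open>m > 0\<close> at most \<open>c / m\<close> indices contribute, each with
  \<open>m\<^sup>2\<close>. The bound is linear in \<open>m\<close>, so that with the mass of a ball
  as \<open>m\<close> it can be integrated over the centre.\<close>

lemma sum_square_le_mult:
  fixes m c :: real
  assumes "0 \<le> m" "0 \<le> c"
  shows "summable (\<lambda>j. if 1 \<le> j \<and> real j * m \<le> c then m\<^sup>2 else 0)"
    and "(\<Sum>j. if 1 \<le> j \<and> real j * m \<le> c then m\<^sup>2 else 0) \<le> c * m"
proof -
  let ?g = "\<lambda>j. if 1 \<le> j \<and> real j * m \<le> c then m\<^sup>2 else 0"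
  have "summable ?g \<and> suminf ?g \<le> c * m"
  proof (cases "m = 0")
    case False
    define n where "n = nat \<lfloor>c / m\<rfloor>"
    have m: "0 < m" using False assms by simp
    have "0 \<le> c / m" using assms by simp
    then have n: "real n \<le> c / m" unfolding n_def by linarith
    have supp: "?g j = 0" if "j \<notin> {1..n}" for j
    proof (cases "1 \<le> j")
      case True
      then have "n < j" using that by auto
      then have "c / m < real j" unfolding n_def by linarith
      then show ?thesis using m by (simp add: field_simps)
    qed simp
    have "summable ?g" by (rule summable_finite[of "{1..n}"]) (use supp in auto)
    moreover have "suminf ?g = sum ?g {1..n}" by (rule suminf_finite) (use supp in auto)
    moreover have "sum ?g {1..n} \<le> (\<Sum>j\<in>{1..n}. m\<^sup>2)" by (intro sum_mono) auto
    moreover have "(\<Sum>j\<in>{1..n}. m\<^sup>2) = real n * m * m" by (simp add: power2_eq_square)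
    moreover have "real n * m * m \<le> c * m" using n m by (intro mult_right_mono) (auto simp: field_simps)
    ultimately show ?thesis by linarith
  next
    case True
    then have "?g = (\<lambda>_. 0)" by auto
    then show ?thesis using True by simp
  qed
  then show "summable ?g" "suminf ?g \<le> c * m" by auto
qed

lemma inverse_square_summable: "summable (\<lambda>n. 1 / (real n)\<^sup>2)"
  using inverse_power_summable[of 2, where 'a = real] by (simp add: inverse_eq_divide)

lemma power_powr_commute:
  fixes a :: real
  assumes "0 < a"
  shows "(a ^ k) powr e = (a powr e) ^ k"
proof -
  have "(a ^ k) powr e = (a powr real k) powr e" using assms by (simp only: powr_realpow)
  also have "\<dots> = (a powr e) powr real k" by (simp only: powr_powr mult.commute)
  also have "\<dots> = (a powr e) ^ k" using assms by (intro powr_realpow) simp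
  finally show ?thesis .
qed

section \<open>The mass of balls under an observation\<close>

locale observed_system = prob_space M
  for M :: "'a::metric_space measure" +
  fixes T :: "'a \<Rightarrow> 'a" and f :: "'a \<Rightarrow> 'b::euclidean_space"
  assumes sets_M: "sets M = sets borel"
    and measurable_T [measurable]: "T \<in> measurable M M"
    and T_preserves: "\<And>A. A \<in> sets M \<Longrightarrow> emeasure M (T -` A \<inter> space M) = emeasure M A"
    and Lipschitz_f: "Lipschitz f"
begin

definition ball_mass :: "'b \<Rightarrow> real \<Rightarrow> real" where
  "ball_mass y r = prob (f -` ball y r)"

lemma space_M [simp]: "space M = UNIV"
  using sets_eq_imp_space_eq[OF sets_M] by simp

lemma measurable_f [measurable]: "f \<in> borel_measurable M"
proof -
  obtain L where "L-lipschitz_on UNIV f" using Lipschitz_f unfolding Lipschitz_def by blast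
  then have "continuous_on UNIV f" by (rule lipschitz_on_continuous_on)
  then have "f \<in> borel_measurable borel" by (rule borel_measurable_continuous_onI)
  then show ?thesis using measurable_cong_sets[OF sets_M refl] by blast
qed

lemma measurable_funpow [measurable]: "T ^^ n \<in> measurable M M"
  by (induction n) (auto intro: measurable_comp measurable_T)

lemma vimage_ball_in_sets [measurable]: "f -` ball y r \<in> sets M"
  using measurable_sets[OF measurable_f, of "ball y r"] by simp

lemma emeasure_vimage_funpow:
  assumes "A \<in> sets M"
  shows "emeasure M ((T ^^ n) -` A) = emeasure M A"
proof (induction n)
  case (Suc n)
  have "(T ^^ n) -` A \<in> sets M"
    using measurable_sets[OF measurable_funpow assms, of n] by simp
  then show ?case
    using T_preserves[of "(T ^^ n) -` A"] Suc by (simp add: vimage_comp funpow_swap1 comp_def)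
qed simp

text \<open>The mass is the measure of a section of a measurable subset of the product.
  Measurability in the centre allows integration over \<open>y\<close> and makes events involving
  the mass about \<open>f x\<close> measurable.\<close>

lemma measurable_ball_mass [measurable]: "(\<lambda>y. ball_mass y r) \<in> borel_measurable borel"
proof -
  have "{p \<in> space (borel \<Otimes>\<^sub>M M). dist (fst p) (f (snd p)) < r} \<in> sets (borel \<Otimes>\<^sub>M M)"
    by measurable
  then have "(\<lambda>y. emeasure M (Pair y -` {p \<in> space (borel \<Otimes>\<^sub>M M). dist (fst p) (f (snd p)) < r}))
      \<in> borel_measurable borel"
    by (rule measurable_emeasure_Pair)
  moreover have "Pair y -` {p \<in> space (borel \<Otimes>\<^sub>M M). dist (fst p) (f (snd p)) < r} = f -` ball y r" for y
    by (auto simp: space_pair_measure)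
  ultimately have "(\<lambda>y. emeasure M (f -` ball y r)) \<in> borel_measurable borel"
    by (simp only:)
  then show ?thesis unfolding ball_mass_def measure_def by measurable
qed

lemma ball_mass_nonneg: "0 \<le> ball_mass y r"
  by (simp add: ball_mass_def)

lemma ball_mass_mono: "dist y z + r \<le> s \<Longrightarrow> ball_mass y r \<le> ball_mass z s"
  unfolding ball_mass_def
proof (intro finite_measure_mono subsetI vimageI2)
  fix x assume "dist y z + r \<le> s" "x \<in> f -` ball y r"
  then show "f x \<in> ball z s"
    using dist_triangle[of z "f x" y] by (simp add: dist_commute)
qed simp

lemma emeasure_vimage_ball: "emeasure M (f -` ball y r) = ennreal (ball_mass y r)"
  by (simp add: ball_mass_def emeasure_eq_measure)

text \<open>Fubini: for fixed \<open>x\<close> the centres \<open>y\<close> with \<open>f x\<close>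
  in \<open>ball y r\<close> form \<open>ball (f x) r\<close>, whose Lebesgue volume does not depend
  on \<open>x\<close>.\<close>

lemma nn_integral_emeasure_vimage_ball:
  assumes S [measurable]: "S \<in> sets M" and "0 \<le> r"
  shows "(\<integral>\<^sup>+y. emeasure M (S \<inter> f -` ball y r) \<partial>lborel)
    = emeasure M S * ennreal (unit_ball_vol DIM('b) * r ^ DIM('b))"
proof -
  interpret P: pair_sigma_finite M "lborel :: 'b measure" ..
  have "(\<integral>\<^sup>+y. emeasure M (S \<inter> f -` ball y r) \<partial>lborel)
      = (\<integral>\<^sup>+y. \<integral>\<^sup>+x. indicator S x * indicator {p. dist (fst p) (f (snd p)) < r} (y, x) \<partial>M \<partial>lborel)"
  proof (intro nn_integral_cong)
    fix y
    have "emeasure M (S \<inter> f -` ball y r) = (\<integral>\<^sup>+x. indicator (S \<inter> f -` ball y r) x \<partial>M)"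
      by (rule nn_integral_indicator[symmetric]) measurable
    also have "\<dots> = (\<integral>\<^sup>+x. indicator S x * indicator {p. dist (fst p) (f (snd p)) < r} (y, x) \<partial>M)"
      by (intro nn_integral_cong) (auto split: split_indicator)
    finally show "emeasure M (S \<inter> f -` ball y r) = \<dots>" .
  qed
  also have "\<dots> = (\<integral>\<^sup>+x. \<integral>\<^sup>+y. indicator S x * indicator {p. dist (fst p) (f (snd p)) < r} (y, x) \<partial>lborel \<partial>M)"
    by (rule P.Fubini') measurable
  also have "\<dots> = (\<integral>\<^sup>+x. indicator S x * ennreal (unit_ball_vol DIM('b) * r ^ DIM('b)) \<partial>M)"
  proof (intro nn_integral_cong)
    fix x
    have "(\<integral>\<^sup>+y. indicator S x * indicator {p. dist (fst p) (f (snd p)) < r} (y, x) \<partial>lborel)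
        = (\<integral>\<^sup>+y. indicator S x * indicator (ball (f x) r) y \<partial>lborel)"
      by (intro nn_integral_cong) (auto simp: dist_commute split: split_indicator)
    also have "\<dots> = indicator S x * emeasure lborel (ball (f x) r)"
      by (rule nn_integral_cmult_indicator) simp
    also have "\<dots> = indicator S x * ennreal (unit_ball_vol DIM('b) * r ^ DIM('b))"
      using assms by (simp add: emeasure_ball)
    finally show "(\<integral>\<^sup>+y. indicator S x * indicator {p. dist (fst p) (f (snd p)) < r} (y, x) \<partial>lborel) = \<dots>" .
  qed
  also have "\<dots> = emeasure M S * ennreal (unit_ball_vol DIM('b) * r ^ DIM('b))"
    by (simp add: nn_integral_multc)
  finally show ?thesis .
qed

text \<open>Integrate \<open>local\<close> over \<open>y\<close>. As \<open>M\<close> has total mass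
  1, the mass term contributes \<open>c\<close> times the volume of a ball of radius
  \<open>R\<close>, and the volume of the unit ball cancels. The indicator keeps the integral of the
  constant error \<open>e\<close> finite.\<close>

lemma prob_le_local_bound:
  assumes S: "S \<in> sets M" and "0 \<le> r" "0 \<le> c" "0 \<le> e" "0 \<le> R" "0 \<le> K"
    and local: "\<And>y. prob (S \<inter> f -` ball y r) \<le> c * ball_mass y R + e * indicator (ball 0 K) y"
  shows "prob S * r ^ DIM('b) \<le> c * R ^ DIM('b) + e * K ^ DIM('b)"
proof -
  define V where "V = unit_ball_vol DIM('b)"
  have V: "0 < V" by (simp add: V_def)
  have mass: "(\<integral>\<^sup>+y. ennreal (ball_mass y R) \<partial>lborel) = ennreal (V * R ^ DIM('b))"
    using nn_integral_emeasure_vimage_ball[of UNIV R] assms emeasure_space_1 sets.top[of M]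
    by (simp add: emeasure_vimage_ball V_def)
  have "ennreal (V * (prob S * r ^ DIM('b))) = (\<integral>\<^sup>+y. emeasure M (S \<inter> f -` ball y r) \<partial>lborel)"
    unfolding nn_integral_emeasure_vimage_ball[OF S \<open>0 \<le> r\<close>] using assms V
    by (simp add: emeasure_eq_measure V_def mult_ac flip: ennreal_mult)
  also have "\<dots> \<le> (\<integral>\<^sup>+y. ennreal c * ennreal (ball_mass y R) + ennreal e * indicator (ball 0 K) y \<partial>lborel)"
  proof (intro nn_integral_mono)
    fix y
    have "emeasure M (S \<inter> f -` ball y r) \<le> ennreal (c * ball_mass y R + e * indicator (ball 0 K) y)"
      using local[of y] by (simp add: emeasure_eq_measure ennreal_leI)
    also have "\<dots> = ennreal c * ennreal (ball_mass y R) + ennreal e * indicator (ball 0 K) y"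
      using assms by (simp add: ennreal_plus ennreal_mult ball_mass_nonneg split: split_indicator)
    finally show "emeasure M (S \<inter> f -` ball y r) \<le> \<dots>" .
  qed
  also have "\<dots> = (\<integral>\<^sup>+y. ennreal c * ennreal (ball_mass y R) \<partial>lborel)
      + (\<integral>\<^sup>+y. ennreal e * indicator (ball (0 :: 'b) K) y \<partial>lborel)"
    by (rule nn_integral_add) (measurable, simp)
  also have "(\<integral>\<^sup>+y. ennreal c * ennreal (ball_mass y R) \<partial>lborel)
      = ennreal c * ennreal (V * R ^ DIM('b))"
    unfolding mass[symmetric] by (rule nn_integral_cmult) measurable
  also have "(\<integral>\<^sup>+y. ennreal e * indicator (ball (0 :: 'b) K) y \<partial>lborel)
      = ennreal e * ennreal (V * K ^ DIM('b))"
    using \<open>0 \<le> K\<close> by (simp add: nn_integral_cmult_indicator emeasure_ball V_def)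
  also have "ennreal c * ennreal (V * R ^ DIM('b)) + ennreal e * ennreal (V * K ^ DIM('b))
      = ennreal (V * (c * R ^ DIM('b) + e * K ^ DIM('b)))"
  proof -
    have "V * (c * R ^ DIM('b) + e * K ^ DIM('b)) = c * (V * R ^ DIM('b)) + e * (V * K ^ DIM('b))"
      by (simp add: algebra_simps)
    then show ?thesis using assms V by (simp add: ennreal_plus ennreal_mult)
  qed
  finally have "V * (prob S * r ^ DIM('b)) \<le> V * (c * R ^ DIM('b) + e * K ^ DIM('b))"
    using assms V by (subst (asm) ennreal_le_iff) auto
  then show ?thesis using V by simp
qed

lemma no_return_in_sets:
  assumes [measurable]: "A \<in> sets M"
  shows "{x \<in> A. \<forall>j. p < j \<and> j \<le> n \<longrightarrow> (T ^^ j) x \<notin> A} \<in> sets M"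
proof -
  have "{x \<in> space M. x \<in> A \<and> (\<forall>j. p < j \<and> j \<le> n \<longrightarrow> (T ^^ j) x \<notin> A)} \<in> sets M" by measurable
  then show ?thesis by simp
qed

text \<open>A point lies in at most \<open>p + 1\<close> of the \<open>n + 1\<close> preimages of the set under \<open>T ^^ i\<close>, \<open>i \<le> n\<close>, which all
  have the same measure: two such times are at most \<open>p\<close> apart.\<close>

lemma prob_no_return_le:
  assumes A [measurable]: "A \<in> sets M"
  shows "prob {x \<in> A. \<forall>j. p < j \<and> j \<le> n \<longrightarrow> (T ^^ j) x \<notin> A} \<le> (real p + 1) / (real n + 1)"
proof -
  define E where "E = {x \<in> A. \<forall>j. p < j \<and> j \<le> n \<longrightarrow> (T ^^ j) x \<notin> A}"
  have E [measurable]: "E \<in> sets M" unfolding E_def by (rule no_return_in_sets[OF A])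
  have visits: "(\<Sum>i\<le>n. indicator E ((T ^^ i) x) :: ennreal) \<le> ennreal (real p + 1)" for x
  proof -
    define I where "I = {i \<in> {..n}. (T ^^ i) x \<in> E}"
    have "card I \<le> p + 1"
    proof (cases "I = {}")
      case False
      have "finite I" by (simp add: I_def)
      define i where "i = Min I"
      have i: "i \<in> I" "\<And>j. j \<in> I \<Longrightarrow> i \<le> j"
        using False \<open>finite I\<close> by (auto simp: i_def)
      have "j \<le> i + p" if "j \<in> I" for j
      proof (rule ccontr)
        assume "\<not> j \<le> i + p"
        then have "p < j - i" "j - i \<le> n" "j = (j - i) + i" using that by (auto simp: I_def)
        moreover have "(T ^^ j) x = (T ^^ (j - i)) ((T ^^ i) x)"
          using \<open>j = (j - i) + i\<close> by (metis comp_apply funpow_add)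
        moreover have "(T ^^ i) x \<in> E" "(T ^^ j) x \<in> A" using i(1) that by (auto simp: I_def E_def)
        ultimately show False by (auto simp: E_def)
      qed
      then have "I \<subseteq> {i..i + p}" using i by auto
      then have "card I \<le> card {i..i + p}" by (intro card_mono) auto
      then show ?thesis by simp
    qed simp
    then have "ennreal (real (card I)) \<le> ennreal (real p + 1)" by (intro ennreal_leI) simp
    moreover have "(\<Sum>i\<le>n. indicator E ((T ^^ i) x) :: ennreal) = (\<Sum>i\<in>I. 1)"
      unfolding I_def by (rule sum.mono_neutral_cong_right) (auto split: split_indicator)
    ultimately show ?thesis by (simp add: ennreal_of_nat_eq_real_of_nat)
  qed
  have "ennreal ((real n + 1) * prob E) = (\<Sum>i\<le>n. emeasure M E)"
    by (simp add: emeasure_eq_measure ennreal_mult ennreal_of_nat_eq_real_of_nat add.commute)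
  also have "\<dots> = (\<Sum>i\<le>n. \<integral>\<^sup>+x. indicator E ((T ^^ i) x) \<partial>M)"
  proof (intro sum.cong refl)
    fix i
    have "(T ^^ i) -` E \<in> sets M" using measurable_sets[OF measurable_funpow E, of i] by simp
    then have "(\<integral>\<^sup>+x. indicator ((T ^^ i) -` E) x \<partial>M) = emeasure M E"
      by (simp add: emeasure_vimage_funpow E)
    then show "emeasure M E = (\<integral>\<^sup>+x. indicator E ((T ^^ i) x) \<partial>M)"
      by (simp add: indicator_def vimage_def)
  qed
  also have "\<dots> = (\<integral>\<^sup>+x. (\<Sum>i\<le>n. indicator E ((T ^^ i) x)) \<partial>M)"
    by (subst nn_integral_sum) measurable
  also have "\<dots> \<le> (\<integral>\<^sup>+x. ennreal (real p + 1) \<partial>M)"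
    by (intro nn_integral_mono visits)
  also have "\<dots> = ennreal (real p + 1)" using emeasure_space_1 by simp
  finally have "(real n + 1) * prob E \<le> real p + 1"
    by (subst (asm) ennreal_le_iff) auto
  then show ?thesis unfolding E_def[symmetric] by (simp add: field_simps)
qed

text \<open>A ball \<open>ball y (r / 2)\<close> containing \<open>f x\<close> lies in
  \<open>ball (f x) r\<close>. If the larger ball has mass zero, so has the smaller one; hence the
  bad points are null in every ball of radius \<open>r / 2\<close>, and therefore null. Later this
  makes the logarithms of masses finite.\<close>

lemma AE_ball_mass_pos: "AE x in M. \<forall>r>0. 0 < ball_mass (f x) r"
proof -
  have "AE x in M. 0 < ball_mass (f x) (1 / real (Suc n))" for n
  proof -
    define r where "r = 1 / real (Suc n)"
    define S where "S = {x. ball_mass (f x) r \<le> 0}"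
    have r: "0 < r" by (simp add: r_def)
    have "{x \<in> space M. ball_mass (f x) r \<le> 0} \<in> sets M" by measurable
    then have S: "S \<in> sets M" by (simp add: S_def)
    \<comment> \<open>Both coefficients on the right vanish, so the radii there can be taken to be
      0.\<close>
    have "prob S * (r / 2) ^ DIM('b) \<le> 0 * 0 ^ DIM('b) + 0 * 0 ^ DIM('b)"
    proof (rule prob_le_local_bound[OF S])
      fix y
      have "prob (S \<inter> f -` ball y (r / 2)) \<le> 0"
      proof (cases "S \<inter> f -` ball y (r / 2) = {}")
        case False
        then obtain x where x: "x \<in> S" "dist y (f x) < r / 2" by auto
        have "prob (S \<inter> f -` ball y (r / 2)) \<le> ball_mass y (r / 2)"
          unfolding ball_mass_def by (intro finite_measure_mono) auto
        also have "\<dots> \<le> ball_mass (f x) r" using x by (intro ball_mass_mono) auto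
        finally show ?thesis using x by (simp add: S_def)
      qed simp
      then show "prob (S \<inter> f -` ball y (r / 2)) \<le> 0 * ball_mass y 0 + 0 * indicator (ball 0 0) y"
        by simp
    qed (use r in auto)
    then have "prob S * (r / 2) ^ DIM('b) \<le> 0 * (r / 2) ^ DIM('b)" by simp
    then have "prob S \<le> 0" by (rule mult_right_le_imp_le) (use r in simp)
    then have "prob S = 0" by (simp add: measure_le_0_iff)
    then have "AE x in M. x \<notin> S" using S by (intro AE_not_in) (auto simp: null_sets_def emeasure_eq_measure)
    then show ?thesis by (simp add: S_def r_def not_le)
  qed
  then have "AE x in M. \<forall>n. 0 < ball_mass (f x) (1 / real (Suc n))" by (simp add: AE_all_countable)
  then show ?thesis
  proof (rule AE_mp, intro AE_I2 impI allI)
    fix x r assume *: "\<forall>n. 0 < ball_mass (f x) (1 / real (Suc n))" and "0 < (r::real)"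
    then obtain n where "1 / real (Suc n) < r" using nat_approx_posE by blast
    then have "ball_mass (f x) (1 / real (Suc n)) \<le> ball_mass (f x) r" by (intro ball_mass_mono) simp
    then show "0 < ball_mass (f x) r" using * less_le_trans by blast
  qed
qed

section \<open>Estimates of return probabilities\<close>

text \<open>Decay is applied with \<open>cutoff y r\<close> composed with \<open>f\<close> as both
  observables. On the event their product is 1, the integral of each is at most the mass of the ball
  of radius \<open>2 * r\<close>, and their Lipschitz norm is of order \<open>1 / r\<close>, whence
  \<open>r\<^sup>2\<close> in the error. The constant is uniform in \<open>y\<close>,
  \<open>r\<close> and \<open>j\<close>.\<close>

lemma prob_pair_hit_le:
  assumes decay: "superpolynomial_decay M T" and "0 < q"
  obtains C where "0 \<le> C"
    "\<And>y r j. 0 < r \<Longrightarrow> r \<le> 1 \<Longrightarrow> 1 \<le> j \<Longrightarrow>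
       prob {x. dist y (f x) < r / 2 \<and> dist (f ((T ^^ j) x)) (f x) < r}
         \<le> (ball_mass y (2 * r))\<^sup>2 + C / (r\<^sup>2 * real j ^ q)"
proof -
  obtain L where L: "L-lipschitz_on UNIV f" using Lipschitz_f unfolding Lipschitz_def by blast
  then have "0 \<le> L" by (rule lipschitz_on_nonneg)
  from decay obtain \<theta> :: "nat \<Rightarrow> real"
    where \<theta>: "\<And>p. 0 < p \<Longrightarrow> (\<lambda>n. \<theta> n * real n powr p) \<longlonglongrightarrow> 0"
      and corr: "\<And>(\<phi> :: 'a \<Rightarrow> real) \<psi> n. bounded (range \<phi>) \<Longrightarrow> Lipschitz \<phi> \<Longrightarrow> bounded (range \<psi>) \<Longrightarrow>
        Lipschitz \<psi> \<Longrightarrow> n \<ge> 1 \<Longrightarrow>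
        \<bar>(\<integral>x. \<phi> ((T ^^ n) x) * \<psi> x \<partial>M) - (\<integral>x. \<phi> x \<partial>M) * (\<integral>x. \<psi> x \<partial>M)\<bar>
          \<le> lipschitz_norm \<phi> * lipschitz_norm \<psi> * \<theta> n"
    unfolding superpolynomial_decay_def by blast
  obtain C where C: "0 \<le> C" "\<And>n. 1 \<le> n \<Longrightarrow> \<bar>\<theta> n\<bar> \<le> C / real n ^ q"
    using superpolynomial_bound[OF \<theta> \<open>0 < q\<close>] by blast
  show thesis
  proof (rule that)
    show "0 \<le> (1 + 2 * L)\<^sup>2 * C" using C by simp
  next
    fix y :: 'b and r :: real and j :: nat
    assume r: "0 < r" "r \<le> 1" and j: "1 \<le> j"
    define \<phi> where "\<phi> x = cutoff y r (f x)" for x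
    have lip: "(2 / r * L)-lipschitz_on UNIV \<phi>"
      unfolding \<phi>_def using lipschitz_on_compose2[OF L lipschitz_on_subset[OF lipschitz_cutoff[OF r(1)]]]
      by simp
    have bd: "\<bar>\<phi> x\<bar> \<le> 1" for x using cutoff_bounds[of y r "f x"] by (simp add: \<phi>_def)
    have "continuous_on UNIV (cutoff y r)"
      using lipschitz_cutoff[OF r(1)] by (rule lipschitz_on_continuous_on)
    then have [measurable]: "cutoff y r \<in> borel_measurable borel"
      by (rule borel_measurable_continuous_onI)
    have [measurable]: "\<phi> \<in> borel_measurable M" unfolding \<phi>_def by measurable
    have int: "integrable M (\<lambda>x. \<phi> ((T ^^ j) x) * \<phi> x)"
      using bd by (intro integrable_const_bound[where B = 1]) (auto simp: abs_mult intro!: mult_le_one)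
    have int\<phi>: "integrable M \<phi>"
      using bd by (intro integrable_const_bound[where B = 1]) auto
    define E where "E = {x. dist y (f x) < r / 2 \<and> dist (f ((T ^^ j) x)) (f x) < r}"
    have "{x \<in> space M. dist y (f x) < r / 2 \<and> dist (f ((T ^^ j) x)) (f x) < r} \<in> sets M" by measurable
    then have E: "E \<in> sets M" by (simp add: E_def)
    have "prob E = (\<integral>x. indicator E x \<partial>M)" using E by simp
    also have "\<dots> \<le> (\<integral>x. \<phi> ((T ^^ j) x) * \<phi> x \<partial>M)"
    proof (rule integral_mono)
      show "integrable M (indicator E :: 'a \<Rightarrow> real)" using E by (simp add: emeasure_eq_measure)
      fix x
      show "indicator E x \<le> \<phi> ((T ^^ j) x) * \<phi> x"
      proof (cases "x \<in> E")
        case True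
        then have d: "dist y (f x) < r / 2" "dist (f ((T ^^ j) x)) (f x) < r" by (auto simp: E_def)
        then have "dist y (f ((T ^^ j) x)) \<le> 3 * r / 2"
          using dist_triangle[of y "f ((T ^^ j) x)" "f x"] by (simp add: dist_commute)
        then show ?thesis using d r by (simp add: \<phi>_def cutoff_eq_1)
      next
        case False
        then show ?thesis by (simp add: \<phi>_def cutoff_bounds)
      qed
    qed (rule int)
    also have "\<dots> \<le> (\<integral>x. \<phi> x \<partial>M) * (\<integral>x. \<phi> x \<partial>M) + lipschitz_norm \<phi> * lipschitz_norm \<phi> * \<theta> j"
    proof -
      have "bounded (range \<phi>)" using bd by (auto simp: bounded_iff)
      moreover have "Lipschitz \<phi>" using lip by (auto simp: Lipschitz_def)
      ultimately show ?thesis using corr[of \<phi> \<phi> j] j by (simp add: abs_le_iff)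
    qed
    also have "\<dots> \<le> (ball_mass y (2 * r))\<^sup>2 + (1 + 2 * L)\<^sup>2 * C / (r\<^sup>2 * real j ^ q)"
    proof (rule add_mono)
      have "(\<integral>x. \<phi> x \<partial>M) \<le> (\<integral>x. indicator (f -` ball y (2 * r)) x \<partial>M)"
      proof (rule integral_mono[OF int\<phi>])
        show "integrable M (indicator (f -` ball y (2 * r)) :: 'a \<Rightarrow> real)"
          by (simp add: emeasure_eq_measure)
        show "\<phi> x \<le> indicator (f -` ball y (2 * r)) x" for x
          using cutoff_bounds[of y r "f x"] cutoff_eq_0[OF r(1), of y "f x"]
          by (auto simp: \<phi>_def indicator_def)
      qed
      then have "(\<integral>x. \<phi> x \<partial>M) \<le> ball_mass y (2 * r)" by (simp add: ball_mass_def)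
      moreover have "0 \<le> (\<integral>x. \<phi> x \<partial>M)" by (intro Bochner_Integration.integral_nonneg) (simp add: \<phi>_def cutoff_bounds)
      ultimately show "(\<integral>x. \<phi> x \<partial>M) * (\<integral>x. \<phi> x \<partial>M) \<le> (ball_mass y (2 * r))\<^sup>2"
        by (simp add: power2_eq_square mult_mono)
      have n: "0 \<le> lipschitz_norm \<phi>" "lipschitz_norm \<phi> \<le> 1 + 2 / r * L"
        using lipschitz_norm_bounds[OF lip bd] by auto
      \<comment> \<open>Here \<open>r \<le> 1\<close> absorbs the sup norm into the term of order
        \<open>1 / r\<close>.\<close>
      have "1 + 2 / r * L \<le> (1 + 2 * L) / r"
        using r \<open>0 \<le> L\<close> by (simp add: field_simps)
      with n have n': "lipschitz_norm \<phi> \<le> (1 + 2 * L) / r" by simp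
      have "lipschitz_norm \<phi> * lipschitz_norm \<phi> * \<theta> j \<le> lipschitz_norm \<phi> * lipschitz_norm \<phi> * (C / real j ^ q)"
        using C(2)[OF j] n by (intro mult_left_mono) auto
      also have "\<dots> \<le> (1 + 2 * L) / r * ((1 + 2 * L) / r) * (C / real j ^ q)"
        using n n' C(1) by (intro mult_right_mono mult_mono) auto
      also have "\<dots> = (1 + 2 * L)\<^sup>2 * C / (r\<^sup>2 * real j ^ q)"
        by (simp add: power2_eq_square)
      finally show "lipschitz_norm \<phi> * lipschitz_norm \<phi> * \<theta> j \<le> \<dots>" .
    qed
    finally show "prob {x. dist y (f x) < r / 2 \<and> dist (f ((T ^^ j) x)) (f x) < r}
         \<le> (ball_mass y (2 * r))\<^sup>2 + (1 + 2 * L)\<^sup>2 * C / (r\<^sup>2 * real j ^ q)"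
      unfolding E_def .
  qed
qed

lemma AE_eventually_not_in:
  assumes "\<And>n. S n \<in> sets M" "\<And>n. prob (S n) \<le> g n" "summable g"
  shows "AE x in M. \<forall>\<^sub>F n in sequentially. x \<notin> S n"
proof -
  have "summable (\<lambda>n. prob (S n))"
    using assms by (intro summable_comparison_test[OF _ assms(3)]) auto
  then show ?thesis using borel_cantelli_AE1[of S M] assms(1) by (simp add: emeasure_eq_measure)
qed

text \<open>Let \<open>A\<close> be the preimage of a ball of radius \<open>r / 2\<close> about
  \<open>y\<close>, and \<open>m\<close> the mass of \<open>ball y (3 * r)\<close>. Two points of
  \<open>A\<close> have images at distance less than \<open>r\<close>, and
  \<open>ball_mass (f x) (2 * r) \<le> m\<close> on \<open>A\<close>. So a bad point of
  \<open>A\<close> avoids \<open>A\<close> from time \<open>p + 1\<close> up to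
  \<open>1 / (c * m)\<close>, and the Kac type bound gives \<open>(p + 1) * c * m\<close>. The 6 is
  the quotient of the radii \<open>3 * r\<close> and \<open>r / 2\<close>.\<close>

lemma prob_late_return_le:
  assumes "0 < r" "0 < c"
  shows "prob {x. \<forall>j>p. real j * ball_mass (f x) (2 * r) \<le> 1 / c \<longrightarrow> r \<le> dist (f ((T ^^ j) x)) (f x)}
    \<le> (real p + 1) * c * 6 ^ DIM('b)"
proof -
  define S where
    "S = {x. \<forall>j>p. real j * ball_mass (f x) (2 * r) \<le> 1 / c \<longrightarrow> r \<le> dist (f ((T ^^ j) x)) (f x)}"
  have "{x \<in> space M. \<forall>j>p. real j * ball_mass (f x) (2 * r) \<le> 1 / c \<longrightarrow> r \<le> dist (f ((T ^^ j) x)) (f x)} \<in> sets M"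
    by measurable
  then have S: "S \<in> sets M" by (simp add: S_def)
  have "prob S * (r / 2) ^ DIM('b) \<le> (real p + 1) * c * (3 * r) ^ DIM('b) + 0 * 0 ^ DIM('b)"
  proof (rule prob_le_local_bound[OF S])
    fix y
    define m where "m = ball_mass y (3 * r)"
    define A where "A = f -` ball y (r / 2)"
    have A: "A \<in> sets M" by (simp add: A_def)
    have "prob (S \<inter> A) \<le> (real p + 1) * c * m"
    proof (cases "m = 0")
      \<comment> \<open>A null ball is treated apart, since \<open>1 / (c * m)\<close> would take
        the default value 0.\<close>
      case True
      have "prob (S \<inter> A) \<le> ball_mass y (r / 2)"
        unfolding ball_mass_def A_def by (intro finite_measure_mono) auto
      also have "\<dots> \<le> m" unfolding m_def using assms by (intro ball_mass_mono) auto
      finally show ?thesis using True by simp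
    next
      case False
      then have m: "0 < m" using ball_mass_nonneg[of y "3 * r"] by (simp add: m_def)
      define n where "n = nat \<lfloor>1 / (c * m)\<rfloor>"
      have "0 \<le> 1 / (c * m)" using m assms by simp
      then have n: "real n \<le> 1 / (c * m)" "1 / (c * m) < real n + 1" unfolding n_def by linarith+
      have "S \<inter> A \<subseteq> {x \<in> A. \<forall>j. p < j \<and> j \<le> n \<longrightarrow> (T ^^ j) x \<notin> A}"
      proof (intro subsetI CollectI conjI allI impI notI)
        fix x j assume x: "x \<in> S \<inter> A" and j: "p < j \<and> j \<le> n" and ret: "(T ^^ j) x \<in> A"
        have "real j * ball_mass (f x) (2 * r) \<le> real n * m"
          unfolding m_def using x j assms by (intro mult_mono ball_mass_mono) (auto simp: A_def dist_commute ball_mass_nonneg)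
        also have "\<dots> \<le> 1 / (c * m) * m" using n(1) m by (intro mult_right_mono) auto
        also have "\<dots> = 1 / c" using m by simp
        finally have "r \<le> dist (f ((T ^^ j) x)) (f x)" using x j by (auto simp: S_def)
        moreover have "dist (f ((T ^^ j) x)) (f x) < r"
          using x ret dist_triangle2[of "f ((T ^^ j) x)" "f x" y] by (simp add: A_def dist_commute)
        ultimately show False by simp
      qed simp
      then have "prob (S \<inter> A) \<le> prob {x \<in> A. \<forall>j. p < j \<and> j \<le> n \<longrightarrow> (T ^^ j) x \<notin> A}"
        by (intro finite_measure_mono no_return_in_sets A)
      also have "\<dots> \<le> (real p + 1) / (real n + 1)" by (rule prob_no_return_le[OF A])
      also have "\<dots> \<le> (real p + 1) / (1 / (c * m))"
        using n m assms by (intro divide_left_mono) auto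
      also have "\<dots> = (real p + 1) * c * m" by simp
      finally show ?thesis .
    qed
    then show "prob (S \<inter> f -` ball y (r / 2))
        \<le> (real p + 1) * c * ball_mass y (3 * r) + 0 * indicator (ball 0 0) y"
      by (simp add: A_def m_def)
  qed (use assms in auto)
  also have "\<dots> = (real p + 1) * c * 6 ^ DIM('b) * (r / 2) ^ DIM('b)"
  proof -
    have "6 * (r / 2) = 3 * r" by simp
    then have "6 ^ DIM('b) * (r / 2) ^ DIM('b) = (3 * r) ^ DIM('b)"
      by (metis power_mult_distrib)
    then show ?thesis by (simp only: mult.assoc add_0_right mult_zero_left)
  qed
  finally have "prob S \<le> (real p + 1) * c * 6 ^ DIM('b)"
    by (rule mult_right_le_imp_le) (use assms in simp)
  then show ?thesis by (simp add: S_def)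
qed

text \<open>With \<open>r = (1 / 2) ^ k\<close> and \<open>c = r powr \<epsilon>\<close>, the
  probability of a late return is a constant times \<open>r powr \<epsilon>\<close>, which is
  geometric in \<open>k\<close>; Borel-Cantelli applies.\<close>

lemma AE_eventually_return:
  assumes "0 < \<epsilon>"
  shows "AE x in M. \<forall>\<^sub>F k in sequentially. \<exists>j>p.
    real j * ball_mass (f x) (2 * (1 / 2) ^ k) \<le> 1 / ((1 / 2) ^ k) powr \<epsilon> \<and>
    dist (f ((T ^^ j) x)) (f x) < (1 / 2) ^ k"
proof -
  define S where "S k = {x. \<forall>j>p. real j * ball_mass (f x) (2 * (1 / 2) ^ k) \<le> 1 / ((1 / 2) ^ k) powr \<epsilon>
      \<longrightarrow> (1 / 2) ^ k \<le> dist (f ((T ^^ j) x)) (f x)}" for k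
  have "AE x in M. \<forall>\<^sub>F k in sequentially. x \<notin> S k"
  proof (rule AE_eventually_not_in)
    fix k
    have "{x \<in> space M. \<forall>j>p. real j * ball_mass (f x) (2 * (1 / 2) ^ k) \<le> 1 / ((1 / 2) ^ k) powr \<epsilon>
      \<longrightarrow> (1 / 2) ^ k \<le> dist (f ((T ^^ j) x)) (f x)} \<in> sets M"
      by measurable
    then show "S k \<in> sets M" by (simp add: S_def)
    show "prob (S k) \<le> (real p + 1) * ((1 / 2) powr \<epsilon>) ^ k * 6 ^ DIM('b)"
      using prob_late_return_le[of "(1 / 2) ^ k" "((1 / 2) ^ k) powr \<epsilon>" p]
      by (simp add: S_def power_powr_commute)
    show "summable (\<lambda>k. (real p + 1) * ((1 / 2) powr \<epsilon>) ^ k * 6 ^ DIM('b))"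
      using assms powr_less_mono2[of \<epsilon> "1 / 2" 1]
      by (intro summable_mult summable_mult2 summable_geometric) auto
  qed
  then show ?thesis by (simp add: S_def not_le)
qed

text \<open>For \<open>f x\<close> within \<open>r / 2\<close> of \<open>y\<close>, the ball of
  radius \<open>2 * r\<close> about \<open>y\<close> has mass
  \<open>m \<le> ball_mass (f x) (3 * r)\<close>, so only times with \<open>j * m \<le> c\<close>
  count. Summing \<open>m\<^sup>2\<close> over them costs at most \<open>c * m\<close>, and
  \<open>B\<close> collects the correlation errors. The bound \<open>K\<close> confines the centres
  to a bounded set, over which these errors can be integrated. The 4 is the quotient of the radii
  \<open>2 * r\<close> and \<open>r / 2\<close>.\<close>

lemma prob_return_le:
  assumes r: "0 < r" "r \<le> 1" and "0 \<le> c" "0 \<le> K"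
    and J: "\<And>j. j \<in> J \<Longrightarrow> 1 \<le> j"
    and B: "summable B" "\<And>j. 0 \<le> B j"
    and hit: "\<And>y j. j \<in> J \<Longrightarrow>
      prob {x. dist y (f x) < r / 2 \<and> dist (f ((T ^^ j) x)) (f x) < r} \<le> (ball_mass y (2 * r))\<^sup>2 + B j"
  shows "prob {x. norm (f x) < K \<and>
      (\<exists>j\<in>J. real j * ball_mass (f x) (3 * r) \<le> c \<and> dist (f ((T ^^ j) x)) (f x) < r)}
    \<le> c * 4 ^ DIM('b) + suminf B * (2 * (K + 1) / r) ^ DIM('b)"
proof -
  define S where "S = {x. norm (f x) < K \<and>
      (\<exists>j\<in>J. real j * ball_mass (f x) (3 * r) \<le> c \<and> dist (f ((T ^^ j) x)) (f x) < r)}"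
  have "{x \<in> space M. norm (f x) < K \<and>
      (\<exists>j\<in>J. real j * ball_mass (f x) (3 * r) \<le> c \<and> dist (f ((T ^^ j) x)) (f x) < r)} \<in> sets M"
    by measurable
  then have S: "S \<in> sets M" by (simp add: S_def)
  have "prob S * (r / 2) ^ DIM('b) \<le> c * (2 * r) ^ DIM('b) + suminf B * (K + 1) ^ DIM('b)"
  proof (rule prob_le_local_bound[OF S])
    show "0 \<le> suminf B" using B by (intro suminf_nonneg) auto
    fix y
    define m where "m = ball_mass y (2 * r)"
    have m: "0 \<le> m" by (simp add: m_def ball_mass_nonneg)
    show "prob (S \<inter> f -` ball y (r / 2)) \<le> c * m + suminf B * indicator (ball 0 (K + 1)) y"
    proof (cases "norm y < K + 1")
      \<comment> \<open>A centre this far out has no \<open>f x\<close> of norm below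
        \<open>K\<close> within \<open>r / 2\<close>, because \<open>r \<le> 1\<close>.\<close>
      case False
      have "S \<inter> f -` ball y (r / 2) = {}"
      proof (rule ccontr)
        assume "S \<inter> f -` ball y (r / 2) \<noteq> {}"
        then obtain x where "norm (f x) < K" "dist y (f x) < r / 2" by (auto simp: S_def)
        then show False using False r norm_triangle_ineq2[of y "f x"] by (simp add: dist_norm)
      qed
      then show ?thesis using False m \<open>0 \<le> c\<close> by simp
    next
      case True
      \<comment> \<open>Times outside the admissible range get the empty set, so the union bound may
        run over all \<open>j\<close>.\<close>
      define E where "E j = (if j \<in> J \<and> real j * m \<le> c
        then {x. dist y (f x) < r / 2 \<and> dist (f ((T ^^ j) x)) (f x) < r} else {})" for j
      define g where "g j = (if 1 \<le> j \<and> real j * m \<le> c then m\<^sup>2 else 0)" for j :: nat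
      have g: "summable g" "suminf g \<le> c * m"
        unfolding g_def using sum_square_le_mult[OF m \<open>0 \<le> c\<close>] by auto
      have E: "E j \<in> sets M" for j
      proof -
        have "{x \<in> space M. dist y (f x) < r / 2 \<and> dist (f ((T ^^ j) x)) (f x) < r} \<in> sets M"
          by measurable
        then show ?thesis by (simp add: E_def)
      qed
      have le: "prob (E j) \<le> g j + B j" for j
        using hit[of j y] J[of j] B(2)[of j] by (auto simp: E_def g_def m_def)
      have sum: "summable (\<lambda>j. g j + B j)" using g B by (intro summable_add)
      then have sumE: "summable (\<lambda>j. prob (E j))"
        by (rule summable_comparison_test[rotated]) (use le in auto)
      have "S \<inter> f -` ball y (r / 2) \<subseteq> (\<Union>j. E j)"
      proof
        fix x assume "x \<in> S \<inter> f -` ball y (r / 2)"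
        then obtain j where x: "dist y (f x) < r / 2" "j \<in> J"
          "real j * ball_mass (f x) (3 * r) \<le> c" "dist (f ((T ^^ j) x)) (f x) < r"
          by (auto simp: S_def)
        have "m \<le> ball_mass (f x) (3 * r)"
          unfolding m_def using x r by (intro ball_mass_mono) auto
        then have "real j * m \<le> real j * ball_mass (f x) (3 * r)" by (intro mult_left_mono) auto
        then show "x \<in> (\<Union>j. E j)" using x by (auto simp: E_def intro!: exI[of _ j])
      qed
      then have "prob (S \<inter> f -` ball y (r / 2)) \<le> prob (\<Union>j. E j)"
        using E by (intro finite_measure_mono) auto
      also have "\<dots> \<le> (\<Sum>j. prob (E j))"
        using E sumE by (intro finite_measure_subadditive_countably) auto
      also have "\<dots> \<le> (\<Sum>j. g j + B j)" using le sumE sum by (intro suminf_le) auto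
      also have "\<dots> = suminf g + suminf B" using g B by (intro suminf_add[symmetric]) auto
      also have "\<dots> \<le> c * m + suminf B" using g by simp
      finally show ?thesis using True by simp
    qed
  qed (use assms in auto)
  also have "\<dots> = (c * 4 ^ DIM('b) + suminf B * (2 * (K + 1) / r) ^ DIM('b)) * (r / 2) ^ DIM('b)"
  proof -
    have "4 * (r / 2) = 2 * r" by simp
    then have "4 ^ DIM('b) * (r / 2) ^ DIM('b) = (2 * r) ^ DIM('b)"
      by (metis power_mult_distrib)
    moreover have "2 * (K + 1) / r * (r / 2) = K + 1" using r by simp
    then have "(2 * (K + 1) / r) ^ DIM('b) * (r / 2) ^ DIM('b) = (K + 1) ^ DIM('b)"
      by (metis power_mult_distrib)
    moreover have "(c * a + s * b) * t = c * (a * t) + s * (b * t)" for a b s t :: real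
      by (simp add: algebra_simps)
    ultimately show ?thesis by (simp only:)
  qed
  finally have "prob S \<le> c * 4 ^ DIM('b) + suminf B * (2 * (K + 1) / r) ^ DIM('b)"
    by (rule mult_right_le_imp_le) (use r in simp)
  then show ?thesis by (simp add: S_def)
qed

text \<open>The exponent \<open>3 * n\<close> makes \<open>r powr (1 / n)\<close> equal to \<open>1 / j ^ 3\<close> at \<open>r = 1 / j ^ (3 * n)\<close>, which is
  summable even after multiplication by \<open>j\<close>.\<close>

lemma AE_eventually_separated:
  assumes decay: "superpolynomial_decay M T" and "1 \<le> n"
  shows "AE x in M. (\<forall>\<^sub>F r in at_right 0. ball_mass (f x) r \<le> r powr (1 / real n)) \<longrightarrow>
    (\<forall>\<^sub>F j in sequentially. 1 / real j ^ (3 * n) \<le> dist (f ((T ^^ j) x)) (f x))"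
proof -
  define b where "b = 3 * n"
  define d where "d = DIM('b)"
  \<comment> \<open>At radius \<open>1 / j ^ b\<close> the correlation error
    \<open>1 / (r\<^sup>2 * j ^ q)\<close> and the factor \<open>1 / r ^ d\<close> from integration
    over the centre multiply to \<open>1 / j\<^sup>2\<close>.\<close>
  define q where "q = b * (d + 2) + 2"
  \<comment> \<open>The shift keeps the radius positive at \<open>j = 0\<close>, where
    \<open>1 / 0\<close> would be 0.\<close>
  define r where "r j = 1 / real (Suc j) ^ b" for j
  obtain C where C: "0 \<le> C" "\<And>y r j. 0 < r \<Longrightarrow> r \<le> 1 \<Longrightarrow> 1 \<le> j \<Longrightarrow>
       prob {x. dist y (f x) < r / 2 \<and> dist (f ((T ^^ j) x)) (f x) < r}
         \<le> (ball_mass y (2 * r))\<^sup>2 + C / (r\<^sup>2 * real j ^ q)"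
    using prob_pair_hit_le[OF decay, of q] by (auto simp: q_def)
  have r: "0 < r j" "r j \<le> 1" for j by (auto simp: r_def)
  \<comment> \<open>Only the time \<open>Suc j\<close> is tested at radius \<open>r j\<close>. The
    threshold is \<open>Suc j\<close> times \<open>3 / Suc j ^ 3\<close>, the bound on the mass at
    radius \<open>3 * r j\<close> that follows from the power law in the premise.\<close>
  define S where "S K j = {x. norm (f x) < real K \<and> (\<exists>i\<in>{Suc j}. real i * ball_mass (f x) (3 * r j)
      \<le> 3 / real (Suc j) ^ 2 \<and> dist (f ((T ^^ i) x)) (f x) < r j)}" for K j
  have "AE x in M. \<forall>\<^sub>F j in sequentially. x \<notin> S K j" for K
  proof (rule AE_eventually_not_in)
    let ?c = "3 * 4 ^ d + C * (2 * (real K + 1)) ^ d"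
    fix j
    have "{x \<in> space M. norm (f x) < real K \<and> (\<exists>i\<in>{Suc j}. real i * ball_mass (f x) (3 * r j)
        \<le> 3 / real (Suc j) ^ 2 \<and> dist (f ((T ^^ i) x)) (f x) < r j)} \<in> sets M"
      by measurable
    then show "S K j \<in> sets M" by (simp add: S_def)
    define B where "B i = (if i = Suc j then C / ((r j)\<^sup>2 * real i ^ q) else 0)" for i
    have B: "B sums (C / ((r j)\<^sup>2 * real (Suc j) ^ q))"
      unfolding B_def by (rule sums_single)
    have "prob (S K j) \<le> 3 / real (Suc j) ^ 2 * 4 ^ d + suminf B * (2 * (real K + 1) / r j) ^ d"
      unfolding S_def d_def
    proof (rule prob_return_le[OF r])
      show "summable B" using B by (rule sums_summable)
      show "0 \<le> B i" for i using C(1) by (simp add: B_def)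
      show "prob {x. dist y (f x) < r j / 2 \<and> dist (f ((T ^^ i) x)) (f x) < r j}
          \<le> (ball_mass y (2 * r j))\<^sup>2 + B i" if "i \<in> {Suc j}" for y i
        using C(2)[OF r, of "Suc j" y j] that by (simp add: B_def)
    qed auto
    also have "suminf B = C / ((r j)\<^sup>2 * real (Suc j) ^ q)" using B by (rule sums_unique[symmetric])
    also have "C / ((r j)\<^sup>2 * real (Suc j) ^ q) * (2 * (real K + 1) / r j) ^ d
        = C * (2 * (real K + 1)) ^ d * (1 / real (Suc j) ^ 2)"
    proof -
      have "real (Suc j) ^ q * (r j ^ 2 * r j ^ d) = real (Suc j) ^ 2"
      proof -
        have "r j ^ 2 * r j ^ d = (1 / real (Suc j) ^ b) ^ (d + 2)"
          by (simp only: r_def add.commute[of d] power_add)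
        also have "\<dots> = 1 / real (Suc j) ^ (b * (d + 2))"
          by (simp only: power_mult power_one_over)
        finally show ?thesis by (simp add: q_def power_add power2_eq_square)
      qed
      then have "C / ((r j)\<^sup>2 * real (Suc j) ^ q) * (2 * (real K + 1) / r j) ^ d
          = C * (2 * (real K + 1)) ^ d / real (Suc j) ^ 2"
        by (simp add: power_divide mult_ac)
      then show ?thesis by simp
    qed
    finally show "prob (S K j) \<le> ?c * (1 / real (Suc j) ^ 2)"
      by (simp add: distrib_right add_divide_distrib)
    have "summable (\<lambda>j. 1 / (real (Suc j))\<^sup>2)"
      using inverse_square_summable by (subst summable_Suc_iff)
    then show "summable (\<lambda>j. ?c * (1 / real (Suc j) ^ 2))" by (rule summable_mult)
  qed
  then have "AE x in M. \<forall>K. \<forall>\<^sub>F j in sequentially. x \<notin> S K j" by (simp add: AE_all_countable)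
  then show ?thesis
  proof (rule AE_mp, intro AE_I2 impI)
    fix x
    assume ev: "\<forall>K. \<forall>\<^sub>F j in sequentially. x \<notin> S K j"
      and reg: "\<forall>\<^sub>F r in at_right 0. ball_mass (f x) r \<le> r powr (1 / real n)"
    obtain K :: nat where K: "norm (f x) < real K" using reals_Archimedean2 by blast
    have "r \<longlonglongrightarrow> 0"
    proof (rule tendsto_sandwich[of "\<lambda>_. 0" _ _ "\<lambda>j. 1 / real (Suc j)"])
      have "1 / real (Suc j) ^ b \<le> 1 / real (Suc j) ^ 1" for j
        using \<open>1 \<le> n\<close> by (intro divide_left_mono power_increasing) (auto simp: b_def)
      then show "\<forall>\<^sub>F j in sequentially. r j \<le> 1 / real (Suc j)" by (simp add: r_def)
      show "(\<lambda>j. 1 / real (Suc j)) \<longlonglongrightarrow> 0"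
        using LIMSEQ_inverse_real_of_nat by (simp add: inverse_eq_divide)
    qed (use r in \<open>auto intro!: always_eventually less_imp_le\<close>)
    then have "(\<lambda>j. 3 * r j) \<longlonglongrightarrow> 3 * 0" by (rule tendsto_mult_left)
    then have "filterlim (\<lambda>j. 3 * r j) (at_right 0) sequentially"
      using r by (intro filterlim_at_withinI) (auto intro!: always_eventually)
    then have "\<forall>\<^sub>F j in sequentially. ball_mass (f x) (3 * r j) \<le> (3 * r j) powr (1 / real n)"
      using reg by (rule eventually_compose_filterlim[rotated])
    with ev[rule_format, of K] have "\<forall>\<^sub>F j in sequentially.
        1 / real (Suc j) ^ (3 * n) \<le> dist (f ((T ^^ Suc j) x)) (f x)"
    proof eventually_elim
      case (elim j)
      have "(3 * r j) powr (1 / real n) = 3 powr (1 / real n) * r j powr (1 / real n)"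
        using r[of j] by (simp add: powr_mult)
      also have "r j powr (1 / real n) = 1 / real (Suc j) ^ 3"
      proof -
        have "r j = (1 / real (Suc j) ^ 3) ^ n"
          by (simp add: r_def b_def power_mult power_one_over)
        then have "r j = (1 / real (Suc j) ^ 3) powr real n"
          by (subst powr_realpow) auto
        then show ?thesis using \<open>1 \<le> n\<close> by (simp add: powr_powr)
      qed
      also have "3 powr (1 / real n) * (1 / real (Suc j) ^ 3) \<le> 3 powr 1 * (1 / real (Suc j) ^ 3)"
        using \<open>1 \<le> n\<close> by (intro mult_right_mono powr_mono) auto
      finally have "ball_mass (f x) (3 * r j) \<le> 3 / real (Suc j) ^ 3" using elim by simp
      then have "real (Suc j) * ball_mass (f x) (3 * r j) \<le> real (Suc j) * (3 / real (Suc j) ^ 3)"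
        by (intro mult_left_mono) auto
      also have "\<dots> = 3 / real (Suc j) ^ 2" by (simp del: of_nat_Suc add: power3_eq_cube power2_eq_square)
      finally have "\<not> dist (f ((T ^^ Suc j) x)) (f x) < r j"
        using elim K by (auto simp: S_def)
      then show ?case by (simp add: r_def b_def)
    qed
    then show "\<forall>\<^sub>F j in sequentially. 1 / real j ^ (3 * n) \<le> dist (f ((T ^^ j) x)) (f x)"
      by (rule eventually_sequentially_Suc[THEN iffD1])
  qed
qed

text \<open>With \<open>r = (1 / 2) ^ k\<close> the range of times is
  \<open>j ^ b \<ge> 1 / r\<close>, where a suitable power of \<open>j\<close> outweighs any given
  power of \<open>1 / r\<close>. The threshold \<open>r powr \<epsilon>\<close> makes the main term
  of the return probability geometric in \<open>k\<close>.\<close>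

lemma AE_eventually_no_intermediate_return:
  assumes decay: "superpolynomial_decay M T" and "0 < \<epsilon>"
  shows "AE x in M. \<forall>\<^sub>F k in sequentially. \<forall>j. 1 \<le> j \<and> 2 ^ k \<le> real j ^ b \<and>
    dist (f ((T ^^ j) x)) (f x) < (1 / 2) ^ k \<longrightarrow>
    ((1 / 2) ^ k) powr \<epsilon> < real j * ball_mass (f x) (3 * (1 / 2) ^ k)"
proof -
  define d where "d = DIM('b)"
  \<comment> \<open>The factor \<open>j ^ (b * (d + 3))\<close> is at least
    \<open>(1 / r) ^ (d + 3)\<close>. It pays for \<open>1 / r\<^sup>2\<close> from the Lipschitz
    norms and \<open>1 / r ^ d\<close> from integration over the centre, and leaves one
    \<open>r\<close> for summation over \<open>k\<close>. The remaining \<open>j\<^sup>2\<close>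
    makes the sum over \<open>j\<close> converge.\<close>
  define q where "q = b * (d + 3) + 2"
  define r :: "nat \<Rightarrow> real" where "r k = (1 / 2) ^ k" for k
  obtain C where C: "0 \<le> C" "\<And>y r j. 0 < r \<Longrightarrow> r \<le> 1 \<Longrightarrow> 1 \<le> j \<Longrightarrow>
       prob {x. dist y (f x) < r / 2 \<and> dist (f ((T ^^ j) x)) (f x) < r}
         \<le> (ball_mass y (2 * r))\<^sup>2 + C / (r\<^sup>2 * real j ^ q)"
    using prob_pair_hit_le[OF decay, of q] by (auto simp: q_def)
  have r: "0 < r k" "r k \<le> 1" for k by (auto simp: r_def power_le_one)
  define J where "J k = {j. 1 \<le> j \<and> 2 ^ k \<le> real j ^ b}" for k :: nat
  define S where "S K k = {x. norm (f x) < real K \<and> (\<exists>j\<in>J k. real j * ball_mass (f x) (3 * r k)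
      \<le> r k powr \<epsilon> \<and> dist (f ((T ^^ j) x)) (f x) < r k)}" for K k
  define Z where "Z = (\<Sum>j. 1 / (real j)\<^sup>2)"
  have "AE x in M. \<forall>\<^sub>F k in sequentially. x \<notin> S K k" for K
  proof (rule AE_eventually_not_in)
    let ?g = "\<lambda>k. ((1 / 2) powr \<epsilon>) ^ k * 4 ^ d + (C * Z * (2 * (real K + 1)) ^ d) * (1 / 2) ^ k"
    fix k
    have "{x \<in> space M. norm (f x) < real K \<and> (\<exists>j\<in>J k. real j * ball_mass (f x) (3 * r k)
      \<le> r k powr \<epsilon> \<and> dist (f ((T ^^ j) x)) (f x) < r k)} \<in> sets M"
      by measurable
    then show "S K k \<in> sets M" by (simp add: S_def)
    define B where "B j = C * r k ^ (d + 1) * (1 / (real j)\<^sup>2)" for j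
    have "prob (S K k) \<le> r k powr \<epsilon> * 4 ^ d + suminf B * (2 * (real K + 1) / r k) ^ d"
      unfolding S_def d_def
    proof (rule prob_return_le[OF r])
      show "summable B" unfolding B_def by (intro summable_mult inverse_square_summable)
      show "0 \<le> B i" for i using C(1) r[of k] by (simp add: B_def)
      show "prob {x. dist y (f x) < r k / 2 \<and> dist (f ((T ^^ j) x)) (f x) < r k}
          \<le> (ball_mass y (2 * r k))\<^sup>2 + B j" if "j \<in> J k" for y j
      proof -
        have j: "1 \<le> j" "2 ^ k \<le> real j ^ b" using that by (auto simp: J_def)
        have "1 / r k = 2 ^ k" by (simp add: r_def power_one_over)
        then have "(1 / r k) ^ (d + 3) \<le> (real j ^ b) ^ (d + 3)"
          using j by (intro power_mono) auto
        then have "(1 / r k) ^ (d + 3) * (real j)\<^sup>2 \<le> real j ^ q"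
          unfolding q_def power_add power_mult by (intro mult_right_mono) auto
        then have "(r k)\<^sup>2 * ((1 / r k) ^ (d + 3) * (real j)\<^sup>2) \<le> (r k)\<^sup>2 * real j ^ q"
          by (intro mult_left_mono) auto
        moreover have "(r k)\<^sup>2 * ((1 / r k) ^ (d + 3) * (real j)\<^sup>2) = (real j)\<^sup>2 / r k ^ (d + 1)"
          using r(1)[of k] by (simp add: power_add power_divide power2_eq_square power3_eq_cube)
        ultimately have "(real j)\<^sup>2 / r k ^ (d + 1) \<le> (r k)\<^sup>2 * real j ^ q" by simp
        then have "C / ((r k)\<^sup>2 * real j ^ q) \<le> C / ((real j)\<^sup>2 / r k ^ (d + 1))"
          using C(1) j r(1)[of k] by (intro divide_left_mono mult_pos_pos divide_pos_pos) auto
        also have "\<dots> = B j" by (simp add: B_def)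
        finally show ?thesis using C(2)[OF r j(1), of y k] by linarith
      qed
    qed (auto simp: J_def)
    also have "suminf B = C * r k ^ (d + 1) * Z"
      unfolding B_def Z_def by (rule suminf_mult[OF inverse_square_summable])
    also have "C * r k ^ (d + 1) * Z * (2 * (real K + 1) / r k) ^ d
        = C * Z * (2 * (real K + 1)) ^ d * r k"
      using r(1)[of k] by (simp add: power_divide)
    also have "r k powr \<epsilon> = ((1 / 2) powr \<epsilon>) ^ k"
      unfolding r_def by (rule power_powr_commute) simp
    finally show "prob (S K k) \<le> ?g k" by (simp add: r_def)
    have "(1 / 2) powr \<epsilon> < (1 :: real)" using powr_less_mono2[of \<epsilon> "1 / 2" 1] \<open>0 < \<epsilon>\<close> by simp
    then show "summable ?g"
      by (intro summable_add summable_mult summable_mult2 summable_geometric) auto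
  qed
  then have "AE x in M. \<forall>K. \<forall>\<^sub>F k in sequentially. x \<notin> S K k" by (simp add: AE_all_countable)
  then show ?thesis
  proof (rule AE_mp, intro AE_I2 impI)
    fix x
    assume ev: "\<forall>K. \<forall>\<^sub>F k in sequentially. x \<notin> S K k"
    obtain K :: nat where K: "norm (f x) < real K" using reals_Archimedean2 by blast
    from ev[rule_format, of K] show "\<forall>\<^sub>F k in sequentially. \<forall>j. 1 \<le> j \<and> 2 ^ k \<le> real j ^ b \<and>
        dist (f ((T ^^ j) x)) (f x) < (1 / 2) ^ k \<longrightarrow>
        ((1 / 2) ^ k) powr \<epsilon> < real j * ball_mass (f x) (3 * (1 / 2) ^ k)"
    proof (eventually_elim, intro allI impI)
      fix k j
      assume "x \<notin> S K k" and j: "1 \<le> j \<and> 2 ^ k \<le> real j ^ b \<and> dist (f ((T ^^ j) x)) (f x) < (1 / 2) ^ k"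
      moreover have "j \<in> J k" using j by (simp add: J_def)
      ultimately have "\<not> real j * ball_mass (f x) (3 * r k) \<le> r k powr \<epsilon>"
        using K by (auto simp: S_def r_def)
      then show "((1 / 2) ^ k) powr \<epsilon> < real j * ball_mass (f x) (3 * (1 / 2) ^ k)"
        by (simp add: r_def)
    qed
  qed
qed

end

section \<open>Logarithmic rates along dyadic radii\<close>

lemma elog_mono:
  assumes "x \<le> y"
  shows "elog x \<le> elog y"
proof (cases "x = 0 \<or> y = \<top>")
  case False
  then have "0 < x" "x < \<top>" "y < \<top>"
    using assms by (auto simp: less_top[symmetric] top_unique zero_less_iff_neq_zero)
  then have "0 < enn2real x" "enn2real x \<le> enn2real y"
    using assms by (auto simp: enn2real_positive_iff enn2real_mono)
  then have "ln (enn2real x) \<le> ln (enn2real y)" by simp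
  then show ?thesis using \<open>0 < x\<close> \<open>x < \<top>\<close> \<open>y < \<top>\<close> assms by (auto simp: elog_def)
qed (auto simp: elog_def)

lemma elog_ennreal: "0 < x \<Longrightarrow> elog (ennreal x) = ereal (ln x)"
  by (simp add: elog_def)

lemma elog_of_nat: "1 \<le> j \<Longrightarrow> elog (of_nat j) = ereal (ln (real j))"
  by (simp add: elog_def flip: ennreal_of_nat_eq_real_of_nat)

lemma return_time_le: "p < j \<Longrightarrow> dist (f ((T ^^ j) x)) (f x) < r \<Longrightarrow> return_time T f r p x \<le> enat j"
  unfolding return_time_def by (intro Inf_lower) (auto simp: dist_commute)

text \<open>A nonempty set of \<open>enat\<close> contains its infimum, so a finite return time is
  the time of an actual return.\<close>

lemma return_time_cases:
  obtains "return_time T f r p x = \<infinity>"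
  | j where "return_time T f r p x = enat j" "p < j" "dist (f ((T ^^ j) x)) (f x) < r"
proof -
  let ?A = "{enat k |k. k > p \<and> f ((T ^^ k) x) \<in> ball (f x) r}"
  show thesis
  proof (cases "?A = {}")
    case True
    then show ?thesis using that(1) by (simp add: return_time_def Inf_enat_def)
  next
    case False
    then have "Inf ?A \<in> ?A" unfolding Inf_enat_def by (auto intro: LeastI)
    then show ?thesis using that(2) by (auto simp: return_time_def dist_commute)
  qed
qed

definition recurrence_quotient ::
  "('a \<Rightarrow> 'a) \<Rightarrow> ('a \<Rightarrow> 'b::metric_space) \<Rightarrow> 'a \<Rightarrow> nat \<Rightarrow> real \<Rightarrow> ereal" where
  "recurrence_quotient T f x p r =
     elog (ennreal_of_enat (return_time T f r p x)) / ereal (- ln r)"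

lemma recurrence_quotient_mono:
  assumes "p \<le> q" "0 < r" "r < 1"
  shows "recurrence_quotient T f x p r \<le> recurrence_quotient T f x q r"
proof -
  have "return_time T f r p x \<le> return_time T f r q x"
    unfolding return_time_def using assms by (intro Inf_superset_mono) auto
  then show ?thesis unfolding recurrence_quotient_def
    using assms by (intro ereal_divide_right_mono elog_mono) auto
qed

lemma eventually_at_right_0_less: "0 < a \<Longrightarrow> \<forall>\<^sub>F r in at_right 0. 0 < r \<and> r < (a :: real)"
  by (auto simp: eventually_at_right_field)

text \<open>For radii below 1 the quotient increases with \<open>p\<close>, so both outer limits are
  suprema. An upper bound on a rate is thus needed for every \<open>p\<close>, while a lower bound
  for a single \<open>p\<close> suffices.\<close>

lemma
  shows lower_recurrence_rate_eq_SUP: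
      "lower_recurrence_rate T f x = (SUP p. Liminf (at_right 0) (recurrence_quotient T f x p))"
    and upper_recurrence_rate_eq_SUP:
      "upper_recurrence_rate T f x = (SUP p. Limsup (at_right 0) (recurrence_quotient T f x p))"
proof -
  have mono: "\<forall>\<^sub>F r in at_right 0. recurrence_quotient T f x p r \<le> recurrence_quotient T f x q r"
    if "p \<le> q" for p q
    using eventually_at_right_0_less[OF zero_less_one] by eventually_elim (use that in \<open>auto intro: recurrence_quotient_mono\<close>)
  have "incseq (\<lambda>p. Liminf (at_right 0) (recurrence_quotient T f x p))"
    "incseq (\<lambda>p. Limsup (at_right 0) (recurrence_quotient T f x p))"
    using mono by (auto intro!: monoI Liminf_mono Limsup_mono)
  then show "lower_recurrence_rate T f x = (SUP p. Liminf (at_right 0) (recurrence_quotient T f x p))"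
    "upper_recurrence_rate T f x = (SUP p. Limsup (at_right 0) (recurrence_quotient T f x p))"
    unfolding lower_recurrence_rate_def upper_recurrence_rate_def recurrence_quotient_def[symmetric, abs_def]
    by (auto intro!: limI LIMSEQ_SUP)
qed

text \<open>Only real numbers below \<open>X\<close> are tested, which spares a case distinction on
  infinite values in the applications.\<close>

lemma ereal_le_approxI:
  fixes X Y :: ereal
  assumes "\<And>c e. ereal c < X \<Longrightarrow> 0 < e \<Longrightarrow> ereal (c - e) \<le> Y"
  shows "X \<le> Y"
proof (rule dense_le)
  fix y assume "y < X"
  show "y \<le> Y"
  proof (cases y)
    case (real c)
    show ?thesis
    proof (rule ereal_le_epsilon2)
      fix e :: real assume "0 < e"
      with \<open>y < X\<close> real have "ereal (c - e) \<le> Y" using assms by simp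
      then show "y \<le> Y + ereal e" using real by (cases Y) auto
    qed
  qed (use \<open>y < X\<close> in auto)
qed

text \<open>The error \<open>(1 + \<bar>c\<bar>) / n\<close> absorbs an additive loss and the loss
  of a factor \<open>1 - 1 / n\<close> at once. Testing real \<open>c\<close> below
  \<open>G s\<close> covers infinite values of \<open>G\<close>, and multiplication by
  \<open>a > 0\<close> preserves the filter \<open>at_right 0\<close>.\<close>

lemma
  fixes F G :: "real \<Rightarrow> ereal" and a :: real
  assumes "0 < a" and cmp: "\<And>n. 1 \<le> n \<Longrightarrow>
    \<forall>\<^sub>F s in at_right 0. \<forall>c. ereal c < G s \<longrightarrow> ereal (c - (1 + \<bar>c\<bar>) / real n) \<le> F (a * s)"
  shows Liminf_le_scaled: "Liminf (at_right 0) G \<le> Liminf (at_right 0) F"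
    and Limsup_le_scaled: "Limsup (at_right 0) G \<le> Limsup (at_right 0) F"
proof -
  have "filtermap ((*) a) (at_right 0) = at_right 0"
    using filtermap_times_pos_at_right[OF \<open>0 < a\<close>, of 0] by simp
  then have scale: "(\<forall>\<^sub>F r in at_right 0. P r) \<longleftrightarrow> (\<forall>\<^sub>F s in at_right 0. P (a * s))" for P
    using eventually_filtermap[of P "(*) a" "at_right 0"] by simp
  have cmp': "\<forall>\<^sub>F s in at_right 0. ereal c < G s \<longrightarrow> ereal (c - e) \<le> F (a * s)" if "0 < e" for c e
  proof -
    obtain n :: nat where n: "(1 + \<bar>c\<bar>) / e < real n" using reals_Archimedean2 by blast
    moreover have "0 < (1 + \<bar>c\<bar>) / e" using that by (intro divide_pos_pos) auto
    ultimately have "0 < real n" by linarith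
    with n that have "(1 + \<bar>c\<bar>) / real n \<le> e" by (simp add: field_simps)
    then have "ereal (c - e) \<le> ereal (c - (1 + \<bar>c\<bar>) / real n)" by simp
    then have "ereal (c - e) \<le> Y" if "ereal (c - (1 + \<bar>c\<bar>) / real n) \<le> Y" for Y
      using that by (rule order_trans)
    moreover have "1 \<le> n" using \<open>0 < real n\<close> by simp
    ultimately show ?thesis using cmp[of n] by (auto elim!: eventually_mono)
  qed
  show "Liminf (at_right 0) G \<le> Liminf (at_right 0) F"
  proof (rule ereal_le_approxI)
    fix c e :: real assume "ereal c < Liminf (at_right 0) G" "0 < e"
    then have "\<forall>\<^sub>F s in at_right 0. ereal c < G s" by (intro less_LiminfD)
    with cmp'[OF \<open>0 < e\<close>, of c] have "\<forall>\<^sub>F s in at_right 0. ereal (c - e) \<le> F (a * s)"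
      by eventually_elim simp
    then show "ereal (c - e) \<le> Liminf (at_right 0) F"
      using scale[of "\<lambda>r. ereal (c - e) \<le> F r"] by (intro Liminf_bounded) simp
  qed
  \<comment> \<open>By contradiction: were \<open>F\<close> eventually below \<open>c - e\<close>,
    then \<open>G\<close> would eventually be at most \<open>c\<close>.\<close>
  show "Limsup (at_right 0) G \<le> Limsup (at_right 0) F"
  proof (rule ereal_le_approxI, rule ccontr)
    fix c e :: real
    assume c: "ereal c < Limsup (at_right 0) G" "0 < e" "\<not> ereal (c - e) \<le> Limsup (at_right 0) F"
    then have "\<forall>\<^sub>F r in at_right 0. F r < ereal (c - e)" by (intro Limsup_lessD) simp
    then have "\<forall>\<^sub>F s in at_right 0. F (a * s) < ereal (c - e)"
      using scale[of "\<lambda>r. F r < ereal (c - e)"] by simp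
    then have "\<forall>\<^sub>F s in at_right 0. G s \<le> ereal c"
      using cmp'[OF c(2), of c] by eventually_elim (auto simp: not_less[symmetric])
    then show False using Limsup_bounded[of G "ereal c" "at_right 0"] c(1) by simp
  qed
qed

section \<open>Passage from dyadic radii to all radii\<close>

lemma dyadic_radius:
  fixes r :: real
  assumes "0 < r" "r < 1"
  obtains k where "(1 / 2) ^ k \<le> r" "r < 2 * (1 / 2) ^ k"
proof -
  define k where "k = (LEAST k. (1 / 2) ^ k \<le> r)"
  obtain k0 where "(1 / 2) ^ k0 < r" using real_arch_pow_inv[OF assms(1), of "1 / 2"] by auto
  then have k: "(1 / 2) ^ k \<le> r" unfolding k_def by (rule LeastI[OF less_imp_le])
  moreover have "k \<noteq> 0"
  proof
    assume "k = 0"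
    then show False using k assms by simp
  qed
  then obtain l where l: "k = Suc l" by (cases k) auto
  then have "l < (LEAST k. (1 / 2) ^ k \<le> r)" by (simp flip: k_def)
  then have "\<not> (1 / 2) ^ l \<le> r" by (rule not_less_Least)
  then have "r < 2 * (1 / 2) ^ k" using l by simp
  ultimately show thesis by (rule that)
qed

text \<open>Borel-Cantelli gives statements along dyadic radii only. A small \<open>r\<close> has a
  dyadic radius within a factor 2 below it, whose index is large because \<open>r\<close> is
  small.\<close>

lemma eventually_dyadic:
  assumes "\<forall>\<^sub>F k in sequentially. P k"
  shows "\<forall>\<^sub>F r in at_right 0. \<exists>k. P k \<and> (1 / 2) ^ k \<le> r \<and> r < 2 * (1 / 2 :: real) ^ k"
proof -
  obtain K where K: "\<And>k. K \<le> k \<Longrightarrow> P k" using assms by (auto simp: eventually_sequentially)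
  have "\<forall>\<^sub>F r in at_right 0. 0 < r \<and> r < (1 / 2 :: real) ^ K" by (intro eventually_at_right_0_less) simp
  then show ?thesis
  proof eventually_elim
    case (elim r)
    then have "r < 1" using power_le_one[of "1 / 2 :: real" K] by simp
    then obtain k where k: "(1 / 2) ^ k \<le> r" "r < 2 * (1 / 2) ^ k"
      using dyadic_radius[of r] elim by metis
    have "K \<le> k"
    proof (rule ccontr)
      assume "\<not> K \<le> k"
      then have "(1 / 2 :: real) ^ K \<le> (1 / 2) ^ k" by (intro power_decreasing) auto
      then show False using k elim by linarith
    qed
    then show ?case using K k by blast
  qed
qed

section \<open>Deterministic comparison at one point, with \<open>m\<close> in the role of the mass
  of balls about \<open>f x\<close>\<close>

context
  fixes T :: "'a \<Rightarrow> 'a" and f :: "'a \<Rightarrow> 'b::metric_space" and x :: 'a and m :: "real \<Rightarrow> real"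
  assumes m_pos: "\<And>r. 0 < r \<Longrightarrow> 0 < m r"
    and m_le_1: "\<And>r. m r \<le> 1"
    and m_mono: "\<And>r s. r \<le> s \<Longrightarrow> m r \<le> m s"
begin

text \<open>For \<open>r\<close> between \<open>(1 / 2) ^ k\<close> and twice that, a return within
  the dyadic radius is one within \<open>r\<close>, and
  \<open>m r \<le> m (2 * (1 / 2) ^ k)\<close>. So
  \<open>j * m r \<le> (2 / r) powr \<epsilon>\<close>; take logarithms and divide by
  \<open>- ln r\<close>.\<close>

lemma recurrence_quotient_le_dimension:
  assumes U: "\<And>n. 1 \<le> n \<Longrightarrow> \<forall>\<^sub>F k in sequentially. \<exists>j>p.
    real j * m (2 * (1 / 2) ^ k) \<le> 1 / ((1 / 2) ^ k) powr (1 / real n) \<and>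
    dist (f ((T ^^ j) x)) (f x) < (1 / 2) ^ k"
    and "1 \<le> n"
  shows "\<forall>\<^sub>F r in at_right 0. \<forall>c. ereal c < recurrence_quotient T f x p r \<longrightarrow>
    ereal (c - (1 + \<bar>c\<bar>) / real n) \<le> ereal (ln (m r) / ln r)"
proof -
  \<comment> \<open>Half of \<open>1 / n\<close>, because bounding \<open>ln (2 / r)\<close> by
    \<open>- 2 * ln r\<close>, valid for \<open>r < 1 / 2\<close>, doubles the error.\<close>
  define \<epsilon> where "\<epsilon> = 1 / real (2 * n)"
  have \<epsilon>: "0 < \<epsilon>" using \<open>1 \<le> n\<close> by (simp add: \<epsilon>_def)
  have "1 \<le> 2 * n" using \<open>1 \<le> n\<close> by simp
  have "\<forall>\<^sub>F r in at_right 0. 0 < r \<and> r < (1 / 2 :: real)" by (rule eventually_at_right_0_less) simp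
  with eventually_dyadic[OF U[OF \<open>1 \<le> 2 * n\<close>]] show ?thesis
  proof (eventually_elim, intro allI impI)
    fix r c assume "0 < r \<and> r < 1 / 2" and lt: "ereal c < recurrence_quotient T f x p r"
      and "\<exists>k. (\<exists>j>p. real j * m (2 * (1 / 2) ^ k) \<le> 1 / ((1 / 2) ^ k) powr (1 / real (2 * n)) \<and>
        dist (f ((T ^^ j) x)) (f x) < (1 / 2) ^ k) \<and> (1 / 2) ^ k \<le> r \<and> r < 2 * (1 / 2) ^ k"
    then obtain k j where j: "p < j" "real j * m (2 * (1 / 2) ^ k) \<le> 1 / ((1 / 2) ^ k) powr \<epsilon>"
        "dist (f ((T ^^ j) x)) (f x) < (1 / 2) ^ k"
      and k: "(1 / 2) ^ k \<le> r" "r < 2 * (1 / 2) ^ k" and r: "0 < r" "r < 1 / 2"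
      by (auto simp: \<epsilon>_def)
    have j1: "1 \<le> j" using j by simp
    have lnr: "ln r < 0" "ln r \<le> - ln 2"
      using r ln_le_cancel_iff[of r "1 / 2"] by (auto simp: ln_div)
    have "real j * m r \<le> real j * m (2 * (1 / 2) ^ k)" using k by (intro mult_left_mono m_mono) auto
    also note j(2)
    also have "1 / ((1 / 2) ^ k) powr \<epsilon> \<le> 1 / (r / 2) powr \<epsilon>"
      using k r \<epsilon> by (intro divide_left_mono powr_mono2 mult_pos_pos) auto
    finally have "ln (real j * m r) \<le> ln (1 / (r / 2) powr \<epsilon>)"
      using j1 m_pos[OF r(1)] r by (subst ln_le_cancel_iff) auto
    then have "ln (real j) + ln (m r) \<le> - (\<epsilon> * (ln r - ln 2))"
      using j1 m_pos[OF r(1)] r by (simp add: ln_mult ln_div)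
    also have "\<dots> = \<epsilon> * (ln 2 - ln r)" by (simp add: algebra_simps)
    also have "\<dots> \<le> \<epsilon> * (2 * - ln r)" using \<epsilon> lnr by (intro mult_left_mono) auto
    finally have "ln (real j) \<le> 2 * \<epsilon> * - ln r - ln (m r)" by simp
    then have "ln (real j) / - ln r \<le> (2 * \<epsilon> * - ln r - ln (m r)) / - ln r"
      using lnr by (intro divide_right_mono) auto
    also have "\<dots> = 2 * \<epsilon> + ln (m r) / ln r" using lnr by (simp add: field_simps)
    finally have bound: "ln (real j) / - ln r \<le> 2 * \<epsilon> + ln (m r) / ln r" .
    have "recurrence_quotient T f x p r \<le> elog (ennreal_of_enat (enat j)) / ereal (- ln r)"
    proof -
      have "return_time T f r p x \<le> enat j" using j k by (intro return_time_le) auto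
      then have "ennreal_of_enat (return_time T f r p x) \<le> ennreal_of_enat (enat j)"
        by (simp only: ennreal_of_enat_le_iff)
      then show ?thesis
        unfolding recurrence_quotient_def using lnr
        by (intro ereal_divide_right_mono elog_mono) auto
    qed
    also have "\<dots> = ereal (ln (real j) / - ln r)" using j1 lnr by (simp add: elog_of_nat)
    finally have "ereal c < ereal (ln (real j) / - ln r)" using lt by (rule less_le_trans[rotated])
    then have "c \<le> 1 / real n + ln (m r) / ln r" using bound by (simp add: \<epsilon>_def)
    moreover have "1 / real n \<le> (1 + \<bar>c\<bar>) / real n" by (intro divide_right_mono) auto
    ultimately show "ereal (c - (1 + \<bar>c\<bar>) / real n) \<le> ereal (ln (m r) / ln r)" by simp
  qed
qed

text \<open>Take \<open>(1 / 2) ^ k\<close> between \<open>s / 8\<close> and \<open>s / 4\<close>. A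
  return within \<open>s / 8\<close> is then one within the dyadic radius, and
  \<open>3 * (1 / 2) ^ k\<close> is less than \<open>s\<close>, so the hypothesis bounds the return
  time at \<open>s / 8\<close> from below through \<open>m s\<close>.\<close>

lemma dimension_le_recurrence_quotient:
  assumes L: "\<And>n. 1 \<le> n \<Longrightarrow> \<forall>\<^sub>F k in sequentially. \<forall>j>p.
    dist (f ((T ^^ j) x)) (f x) < (1 / 2) ^ k \<longrightarrow>
    ((1 / 2) ^ k) powr (1 / real n) < real j * m (3 * (1 / 2) ^ k)"
    and "1 \<le> n"
  shows "\<forall>\<^sub>F s in at_right 0. \<forall>c. ereal c < ereal (ln (m s) / ln s) \<longrightarrow>
    ereal (c - (1 + \<bar>c\<bar>) / real n) \<le> recurrence_quotient T f x p (1 / 8 * s)"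
proof -
  define \<epsilon> where "\<epsilon> = 1 / real n"
  have \<epsilon>: "0 < \<epsilon>" "\<epsilon> \<le> 1" using \<open>1 \<le> n\<close> by (auto simp: \<epsilon>_def)
  define P where "P k \<longleftrightarrow> (\<forall>j>p. dist (f ((T ^^ j) x)) (f x) < (1 / 2) ^ k \<longrightarrow>
      ((1 / 2) ^ k) powr \<epsilon> < real j * m (3 * (1 / 2) ^ k))" for k
  have "filtermap ((*) (1 / 4)) (at_right 0) = at_right (0 :: real)"
    using filtermap_times_pos_at_right[of "1 / 4 :: real" 0] by simp
  moreover have "\<forall>\<^sub>F r in at_right 0. \<exists>k. P k \<and> (1 / 2) ^ k \<le> r \<and> r < 2 * (1 / 2 :: real) ^ k"
    unfolding P_def \<epsilon>_def by (intro eventually_dyadic L \<open>1 \<le> n\<close>)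
  ultimately have "\<forall>\<^sub>F r in filtermap ((*) (1 / 4)) (at_right 0).
      \<exists>k. P k \<and> (1 / 2) ^ k \<le> r \<and> r < 2 * (1 / 2 :: real) ^ k"
    by (simp only:)
  then have "\<forall>\<^sub>F s in at_right 0.
      \<exists>k. P k \<and> (1 / 2) ^ k \<le> 1 / 4 * s \<and> 1 / 4 * s < 2 * (1 / 2 :: real) ^ k"
    by (simp only: eventually_filtermap)
  \<comment> \<open>The exponential bound gives \<open>\<epsilon> * ln s < - ln 8\<close>, so that
    passing from \<open>ln s\<close> to \<open>ln (s / 8)\<close> costs only a factor
    \<open>1 - \<epsilon>\<close>.\<close>
  moreover have "\<forall>\<^sub>F s in at_right 0. 0 < s \<and> s < min 1 (exp (- ln 8 / \<epsilon>))"
    by (intro eventually_at_right_0_less) simp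
  ultimately show ?thesis
  proof (eventually_elim, intro allI impI)
    fix s c :: real
    assume "\<exists>k. P k \<and> (1 / 2) ^ k \<le> 1 / 4 * s \<and> 1 / 4 * s < 2 * (1 / 2) ^ k"
    then obtain k where k: "(1 / 2) ^ k \<le> 1 / 4 * s" "1 / 4 * s < 2 * (1 / 2) ^ k"
      and j: "\<And>j. p < j \<Longrightarrow> dist (f ((T ^^ j) x)) (f x) < (1 / 2) ^ k \<Longrightarrow>
        ((1 / 2) ^ k) powr \<epsilon> < real j * m (3 * (1 / 2) ^ k)"
      unfolding P_def by blast
    assume "0 < s \<and> s < min 1 (exp (- ln 8 / \<epsilon>))" and "ereal c < ereal (ln (m s) / ln s)"
    then have s: "0 < s" "s < 1" "s < exp (- ln 8 / \<epsilon>)" and c: "c < ln (m s) / ln s" by auto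
    define t where "t = 1 / 8 * s"
    have t: "0 < t" "t < 1" using s by (auto simp: t_def)
    have lns: "ln s < 0" using s by simp
    have lnt: "ln t = ln s - ln 8" using s by (simp add: t_def ln_div)
    have lnt0: "ln t < 0" using t by simp
    have "ln s < - ln 8 / \<epsilon>" using s ln_less_cancel_iff[of s "exp (- ln 8 / \<epsilon>)"] by simp
    then have "\<epsilon> * ln s < - ln 8" using \<epsilon> by (simp add: field_simps)
    also have "\<dots> \<le> - ((1 - \<epsilon>) * ln 8)" using \<epsilon> by (simp add: mult_le_cancel_right1)
    finally have "ln s \<le> (1 - \<epsilon>) * ln t" by (simp add: lnt algebra_simps)
    then have ratio: "1 - \<epsilon> \<le> ln s / ln t" using lnt0 by (simp add: neg_le_divide_eq)
    have ms: "0 < m s" "ln (m s) \<le> 0" using m_pos[OF s(1)] m_le_1[of s] by auto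
    \<comment> \<open>The sign, due to \<open>m s \<le> 1\<close>, permits multiplying
      \<open>ratio\<close> by this quotient.\<close>
    have g: "0 \<le> ln (m s) / ln s" using ms lns by (simp add: divide_nonpos_neg)
    have "(1 - \<epsilon>) * c \<le> (1 - \<epsilon>) * (ln (m s) / ln s)" using c \<epsilon> by (intro mult_left_mono) auto
    also have "\<dots> \<le> ln s / ln t * (ln (m s) / ln s)" using g ratio by (rule mult_right_mono[rotated])
    also have "\<dots> = ln (m s) / ln t" using lns by simp
    finally have 1: "(1 - \<epsilon>) * c \<le> ln (m s) / ln t" .
    \<comment> \<open>The additive loss \<open>\<epsilon>\<close> and the loss
      \<open>\<epsilon> * c\<close> from the factor \<open>1 - \<epsilon>\<close> add up to at most
      \<open>(1 + \<bar>c\<bar>) / n\<close>.\<close>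
    have "\<epsilon> * c \<le> \<epsilon> * \<bar>c\<bar>" using \<epsilon> by (intro mult_left_mono) auto
    then have "c - (1 + \<bar>c\<bar>) / real n \<le> (1 - \<epsilon>) * c - \<epsilon>"
      by (simp add: \<epsilon>_def algebra_simps add_divide_distrib)
    with 1 have 2: "c - (1 + \<bar>c\<bar>) / real n \<le> ln (m s) / ln t - \<epsilon>" by simp
    show "ereal (c - (1 + \<bar>c\<bar>) / real n) \<le> recurrence_quotient T f x p (1 / 8 * s)"
    proof (cases rule: return_time_cases[of T f t p x])
      \<comment> \<open>Without a return the quotient is infinite.\<close>
      case 1
      then show ?thesis using lnt0 by (simp add: recurrence_quotient_def elog_def t_def)
    next
      case (2 j')
      have "t \<le> (1 / 2) ^ k" using k by (simp add: t_def)
      then have "t powr \<epsilon> \<le> ((1 / 2) ^ k) powr \<epsilon>" using t \<epsilon> by (intro powr_mono2) auto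
      also have "\<dots> < real j' * m (3 * (1 / 2) ^ k)" using 2 \<open>t \<le> (1 / 2) ^ k\<close> by (intro j) auto
      also have "\<dots> \<le> real j' * m s" using k s by (intro mult_left_mono m_mono) auto
      finally have "ln (t powr \<epsilon>) \<le> ln (real j' * m s)" using t 2 ms by (subst ln_le_cancel_iff) auto
      then have "\<epsilon> * ln t - ln (m s) \<le> ln (real j')" using t 2 ms by (simp add: ln_mult)
      then have "(\<epsilon> * ln t - ln (m s)) / - ln t \<le> ln (real j') / - ln t"
        using lnt0 by (intro divide_right_mono) auto
      moreover have "(\<epsilon> * ln t - ln (m s)) / - ln t = ln (m s) / ln t - \<epsilon>"
        using lnt0 by (simp add: field_simps)
      ultimately have "c - (1 + \<bar>c\<bar>) / real n \<le> ln (real j') / - ln t"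
        using \<open>c - (1 + \<bar>c\<bar>) / real n \<le> ln (m s) / ln t - \<epsilon>\<close> by simp
      moreover have "recurrence_quotient T f x p t = ereal (ln (real j') / - ln t)"
        using 2 lnt0 by (simp add: recurrence_quotient_def elog_of_nat)
      ultimately show ?thesis by (simp add: t_def)
    qed
  qed
qed

end

section \<open>Recurrence rates and dimensions\<close>

context observed_system
begin

lemma dimension_quotient_eq:
  assumes "0 < ball_mass (f x) r" "0 < r" "r < 1"
  shows "elog (emeasure (distr M borel f) (ball (f x) r)) / ereal (ln r)
    = ereal (ln (ball_mass (f x) r) / ln r)"
proof -
  have "emeasure (distr M borel f) (ball (f x) r) = ennreal (ball_mass (f x) r)"
    by (simp add: emeasure_distr emeasure_vimage_ball)
  then show ?thesis using assms by (simp add: elog_ennreal)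
qed

theorem AE_recurrence_rate_eq_dimension:
  assumes decay: "superpolynomial_decay M T"
  shows "AE x in M. lower_dimension_obs M f x > 0 \<longrightarrow>
           lower_recurrence_rate T f x = lower_dimension_obs M f x \<and>
           upper_recurrence_rate T f x = upper_dimension_obs M f x"
proof -
  \<comment> \<open>The exceptional sets are united over the countably many values of
    \<open>p\<close>, \<open>b\<close> and \<open>n\<close>; from then on the argument takes place
    at one fixed point.\<close>
  have "AE x in M. \<forall>p. \<forall>n\<ge>1. \<forall>\<^sub>F k in sequentially. \<exists>j>p.
      real j * ball_mass (f x) (2 * (1 / 2) ^ k) \<le> 1 / ((1 / 2) ^ k) powr (1 / real n) \<and>
      dist (f ((T ^^ j) x)) (f x) < (1 / 2) ^ k"
    unfolding AE_all_countable by (auto intro!: AE_eventually_return AE_impI)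
  moreover have "AE x in M. \<forall>b. \<forall>n\<ge>1. \<forall>\<^sub>F k in sequentially. \<forall>j. 1 \<le> j \<and> 2 ^ k \<le> real j ^ b \<and>
      dist (f ((T ^^ j) x)) (f x) < (1 / 2) ^ k \<longrightarrow>
      ((1 / 2) ^ k) powr (1 / real n) < real j * ball_mass (f x) (3 * (1 / 2) ^ k)"
    unfolding AE_all_countable by (intro allI AE_impI AE_eventually_no_intermediate_return decay) simp
  moreover have "AE x in M. \<forall>n\<ge>1. (\<forall>\<^sub>F r in at_right 0. ball_mass (f x) r \<le> r powr (1 / real n)) \<longrightarrow>
      (\<forall>\<^sub>F j in sequentially. 1 / real j ^ (3 * n) \<le> dist (f ((T ^^ j) x)) (f x))"
    unfolding AE_all_countable by (intro allI AE_impI AE_eventually_separated decay)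
  ultimately show ?thesis
    using AE_ball_mass_pos
  proof (eventually_elim, intro impI)
    fix x
    assume return: "\<forall>p. \<forall>n\<ge>1. \<forall>\<^sub>F k in sequentially. \<exists>j>p.
        real j * ball_mass (f x) (2 * (1 / 2) ^ k) \<le> 1 / ((1 / 2) ^ k) powr (1 / real n) \<and>
        dist (f ((T ^^ j) x)) (f x) < (1 / 2) ^ k"
      and intermediate: "\<forall>b. \<forall>n\<ge>1. \<forall>\<^sub>F k in sequentially. \<forall>j. 1 \<le> j \<and> 2 ^ k \<le> real j ^ b \<and>
        dist (f ((T ^^ j) x)) (f x) < (1 / 2) ^ k \<longrightarrow>
        ((1 / 2) ^ k) powr (1 / real n) < real j * ball_mass (f x) (3 * (1 / 2) ^ k)"
      and separated: "\<forall>n\<ge>1. (\<forall>\<^sub>F r in at_right 0. ball_mass (f x) r \<le> r powr (1 / real n)) \<longrightarrow>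
        (\<forall>\<^sub>F j in sequentially. 1 / real j ^ (3 * n) \<le> dist (f ((T ^^ j) x)) (f x))"
      and pos: "\<forall>r>0. 0 < ball_mass (f x) r"
      and dim_pos: "lower_dimension_obs M f x > 0"
    define m where "m = ball_mass (f x)"
    define G where "G r = ereal (ln (m r) / ln r)" for r
    have m: "\<And>r. 0 < r \<Longrightarrow> 0 < m r" "\<And>r. m r \<le> 1" "\<And>r s. r \<le> s \<Longrightarrow> m r \<le> m s"
      using pos by (auto simp: m_def ball_mass_def[of "f x"] intro: ball_mass_mono[unfolded ball_mass_def])
    have small: "\<forall>\<^sub>F r in at_right 0. 0 < r \<and> r < (1 :: real)" by (rule eventually_at_right_0_less) simp
    have G: "\<forall>\<^sub>F r in at_right 0. elog (emeasure (distr M borel f) (ball (f x) r)) / ereal (ln r) = G r"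
      using small by eventually_elim (use pos in \<open>simp add: dimension_quotient_eq G_def m_def\<close>)
    have dims: "lower_dimension_obs M f x = Liminf (at_right 0) G"
      "upper_dimension_obs M f x = Limsup (at_right 0) G"
      unfolding lower_dimension_obs_def lower_dimension_def upper_dimension_obs_def upper_dimension_def
      using G by (auto intro: Liminf_eq Limsup_eq)
    \<comment> \<open>Proved for every \<open>p\<close>, as the supremum requires. No rescaling of
      the radius occurs, so \<open>a = 1\<close>.\<close>
    have upper: "Liminf (at_right 0) (recurrence_quotient T f x p) \<le> Liminf (at_right 0) G"
      "Limsup (at_right 0) (recurrence_quotient T f x p) \<le> Limsup (at_right 0) G" for p
    proof -
      have cmp: "\<forall>\<^sub>F s in at_right 0. \<forall>c. ereal c < recurrence_quotient T f x p s \<longrightarrow>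
          ereal (c - (1 + \<bar>c\<bar>) / real n) \<le> G (1 * s)" if "1 \<le> n" for n
        unfolding G_def mult_1
        by (rule recurrence_quotient_le_dimension[OF m _ that]) (use return in \<open>simp_all add: m_def\<close>)
      show "Liminf (at_right 0) (recurrence_quotient T f x p) \<le> Liminf (at_right 0) G"
        by (rule Liminf_le_scaled[OF zero_less_one cmp])
      show "Limsup (at_right 0) (recurrence_quotient T f x p) \<le> Limsup (at_right 0) G"
        by (rule Limsup_le_scaled[OF zero_less_one cmp])
    qed
    \<comment> \<open>A single \<open>p\<close> suffices for the supremum: a time after which the
      orbit is separated from its starting point.\<close>
    obtain p where lower: "Liminf (at_right 0) G \<le> Liminf (at_right 0) (recurrence_quotient T f x p)"
      "Limsup (at_right 0) G \<le> Limsup (at_right 0) (recurrence_quotient T f x p)"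
    proof -
      obtain a where a: "0 < a" "ereal a < Liminf (at_right 0) G"
        using dim_pos dims(1) ereal_dense2[of 0] by (metis ereal_less(2))
      obtain n' where "1 / real (Suc n') < a" using nat_approx_posE[OF a(1)] by blast
      then obtain n where n: "1 \<le> n" "1 / real n < a" by (intro that[of "Suc n'"]) auto
      \<comment> \<open>Positive lower dimension becomes a power law for the mass;
        \<open>ln r < 0\<close> reverses the inequality.\<close>
      have "\<forall>\<^sub>F r in at_right 0. m r \<le> r powr (1 / real n)"
        using less_LiminfD[OF a(2)] small
      proof eventually_elim
        case (elim r)
        then have "1 / real n < ln (m r) / ln r" using n by (simp add: G_def)
        then have "ln (m r) \<le> ln (r powr (1 / real n))"
          using elim by (simp add: neg_less_divide_eq)
        moreover have "0 < m r" "0 < r powr (1 / real n)" using elim m(1) by auto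
        ultimately show ?case by (simp only: ln_le_cancel_iff)
      qed
      then have "\<forall>\<^sub>F j in sequentially. 1 / real j ^ (3 * n) \<le> dist (f ((T ^^ j) x)) (f x)"
        using separated n by (simp add: m_def)
      then obtain p where p: "\<And>j. p \<le> j \<Longrightarrow> 1 / real j ^ (3 * n) \<le> dist (f ((T ^^ j) x)) (f x)"
        by (auto simp: eventually_sequentially)
      have L: "\<forall>\<^sub>F k in sequentially. \<forall>j>p. dist (f ((T ^^ j) x)) (f x) < (1 / 2) ^ k \<longrightarrow>
          ((1 / 2) ^ k) powr (1 / real q) < real j * m (3 * (1 / 2) ^ k)" if "1 \<le> q" for q
        using intermediate[rule_format, OF that, of "3 * n"]
      proof (eventually_elim, intro allI impI)
        fix k j
        assume imp: "\<forall>j. 1 \<le> j \<and> 2 ^ k \<le> real j ^ (3 * n) \<and>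
            dist (f ((T ^^ j) x)) (f x) < (1 / 2) ^ k \<longrightarrow>
            ((1 / 2) ^ k) powr (1 / real q) < real j * ball_mass (f x) (3 * (1 / 2) ^ k)"
          and j: "p < j" "dist (f ((T ^^ j) x)) (f x) < (1 / 2) ^ k"
        \<comment> \<open>A return within \<open>(1 / 2) ^ k\<close> after time \<open>p\<close>
          must respect the separation, hence \<open>j ^ (3 * n) > 2 ^ k\<close>. With
          \<open>b = 3 * n\<close> every such return lies in the range of
          \<open>intermediate\<close>.\<close>
        have "1 / real j ^ (3 * n) < (1 / 2) ^ k" using p[of j] j by simp
        then have "2 ^ k \<le> real j ^ (3 * n)"
          using j(1) by (simp add: power_one_over field_simps)
        then show "((1 / 2) ^ k) powr (1 / real q) < real j * m (3 * (1 / 2) ^ k)"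
          using imp j by (simp add: m_def)
      qed
      have "\<forall>\<^sub>F s in at_right 0. \<forall>c. ereal c < G s \<longrightarrow>
          ereal (c - (1 + \<bar>c\<bar>) / real q) \<le> recurrence_quotient T f x p (1 / 8 * s)" if "1 \<le> q" for q
        unfolding G_def by (rule dimension_le_recurrence_quotient[OF m L that])
      moreover have "0 < (1 / 8 :: real)" by simp
      ultimately show thesis by (intro that[of p] Liminf_le_scaled Limsup_le_scaled)
    qed
    have "(SUP p. Liminf (at_right 0) (recurrence_quotient T f x p)) = Liminf (at_right 0) G"
      "(SUP p. Limsup (at_right 0) (recurrence_quotient T f x p)) = Limsup (at_right 0) G"
      using upper lower by (auto intro!: antisym SUP_least intro: SUP_upper2)
    then show "lower_recurrence_rate T f x = lower_dimension_obs M f x \<and>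
        upper_recurrence_rate T f x = upper_dimension_obs M f x"
      by (simp add: dims lower_recurrence_rate_eq_SUP upper_recurrence_rate_eq_SUP)
  qed
qed

end

theorem theorem5:
  fixes M :: "'a::metric_space measure"
    and T :: "'a \<Rightarrow> 'a"
    and f :: "'a \<Rightarrow> real ^ 'n"
  assumes "sets M = sets borel"
    and "measure_preserving_system M T"
    and "superpolynomial_decay M T"
    and "Lipschitz f"
  shows "AE x in M. lower_dimension_obs M f x > 0 \<longrightarrow>
           lower_recurrence_rate T f x = lower_dimension_obs M f x \<and>
           upper_recurrence_rate T f x = upper_dimension_obs M f x"
proof -
  interpret prob_space M using assms(2) by (simp add: measure_preserving_system_def)
  interpret observed_system M T f
    by standard (use assms in \<open>auto simp: measure_preserving_system_def\<close>)
  show ?thesis by (rule AE_recurrence_rate_eq_dimension) fact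
qed

end
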